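(* The group $\widehat{2V}$ is presented, as a group, by the generating set $\{v_i,h_i,\sigma_i\mid i\in\{0,1\}\}$ and the following 40 relations, where for $i\ge2$ the symbols $v_i,h_i,\sigma_i$ abbreviate $$v_i=v_0^{1-i}v_1v_0^{i-1},\qquad h_i=v_0^{1-i}h_1v_0^{i-1},\qquad \sigma_i=v_0^{1-i}\sigma_1v_0^{i-1}:$$ $v_2v_1=v_1v_3$, $v_3v_1=v_1v_4$, $h_2v_1=v_1h_3$, $h_3v_1=v_1h_4$, $v_1h_0=h_0v_2$, $v_2h_0=h_0v_3$, $v_2h_1=h_1v_3$, $v_3h_1=h_1v_4$, $h_1h_0=h_0h_2$, $h_2h_0=h_0h_3$, $h_2h_1=h_1h_3$, $h_3h_1=h_1h_4$, $\sigma_0v_2=v_2\sigma_0$, $\sigma_0v_3=v_3\sigma_0$, $\sigma_1v_3=v_3\sigma_1$, $\sigma_1v_4=v_4\sigma_1$, $\sigma_0h_2=h_2\sigma_0$, $\sigma_0h_3=h_3\sigma_0$, $\sigma_1h_3=h_3\sigma_1$, $\sigma_1h_4=h_4\sigma_1$, $\sigma_0v_0=v_1\sigma_0\sigma_1$, $\sigma_1v_1=v_2\sigma_1\sigma_2$, $\sigma_0h_0=h_1\sigma_0\sigma_1$, $\sigma_1h_1=h_2\sigma_1\sigma_2$, $\sigma_1h_0=h_0\sigma_2$, $\sigma_2h_0=h_0\sigma_3$, $\sigma_2h_1=h_1\sigma_3$, $\sigma_3h_1=h_1\sigma_4$, $\sigma_2v_1=v_1\sigma_3$, $\sigma_3v_1=v_1\sigma_4$,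 $\sigma_0^2=1$, $\sigma_1^2=1$, $\sigma_0\sigma_2=\sigma_2\sigma_0$, $\sigma_0\sigma_3=\sigma_3\sigma_0$, $\sigma_1\sigma_3=\sigma_3\sigma_1$, $\sigma_1\sigma_4=\sigma_4\sigma_1$, $\sigma_0\sigma_1\sigma_0=\sigma_1\sigma_0\sigma_1$, $\sigma_1\sigma_2\sigma_1=\sigma_2\sigma_1\sigma_2$, $v_0h_1h_0=h_0v_1v_0\sigma_1$, $v_1h_2h_1=h_1v_2v_1\sigma_2$.
   Context: $\mathbb N=\{0,1,2,\dots\}$. For $i\in\mathbb N$ let $S_i=[2i,2i+1]\times[0,1]$. Let $C\subset[0,1]$ be the usual middle-thirds Cantor set and $Y=\bigcup_{i\in\mathbb N}(2i+C)\times C$. The trivial pattern is $\{S_i\mid i\in\mathbb N\}$. A simple increment of a pattern replaces one rectangle $R$ of the pattern either by its (closed) left third and right third (vertical division) or by its (closed) bottom third and top third (horizontal division), leaving the other rectangles alone. A pattern is a set of rectangles obtainable from the trivial pattern by finitely many simple increments. A numbered pattern is a bijection from $\mathbb N$ to the rectangles of a pattern for which there are $j,k\in\mathbb N$ such that for every $i>k$ the square $S_i$ contains only one rectangle of the pattern and its number is $i+j$. A pair $(P,Q)$ of numbered patterns defines a homeomorphism of $Y$: for each $i$, it takes the intersection of $Y$ with the $i$-th rectangle of $Q$ onto the intersection of $Y$ with the $i$-th rectangle of $P$ by the unique affine map of the form $(x,y)\mapsto(a+3^jx,b+3^ky)$, $j,k\in\mathbb Z$, that does so. The group $\widehat{2V}$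 is the set of all homeomorphisms of $Y$ obtained this way, under composition (acting on the left, composed right to left). Let $E$ be the trivial pattern with $S_i$ numbered $i$. A numbered pattern $P$ is identified with the element $(P,E)$ of $\widehat{2V}$, so that $(P,Q)=PQ^{-1}$. Special elements, for $i\in\mathbb N$: $v_i$ is the numbered pattern (element) in which $S_i$ is divided vertically, with left piece numbered $i$ and right piece numbered $i+1$, and every $S_j$ with $j\neq i$ is a single rectangle, numbered $j$ if $j<i$ and $j+1$ if $j>i$. $h_i$ is defined in the same way with $S_i$ divided horizontally, the bottom piece numbered $i$ and the top piece numbered $i+1$. $\sigma_i$ is the trivial pattern with $S_i$ numbered $i+1$, $S_{i+1}$ numbered $i$, and $S_j$ numbered $j$ for $j\notin\{i,i+1\}$. (For $i\ge 2$ these elements satisfy the abbreviating formulas in the claim.) *)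

theory Defs
  imports Complex_Main "HOL-Algebra.Bij" "HOL-Algebra.Generated_Groups"
begin

text \<open>A word is a list of letters; the letter \<open>(x, True)\<close> stands for the generator \<open>x\<close>
  and \<open>(x, False)\<close> for its inverse. The free group on the type \<open>'x\<close> consists of the
  classes of words modulo insertion and deletion of adjacent inverse letters.\<close>

type_synonym 'x word = "('x \<times> bool) list"

definition cancellation :: "('x word \<times> 'x word) set" where
  "cancellation = {(u @ [(x, b), (x, \<not> b)] @ w, u @ w) | u x b w. True}"

definition free_equiv :: "('x word \<times> 'x word) set" where
  "free_equiv = (cancellation \<union> cancellation\<inverse>)\<^sup>*"

definition free_group :: "'x word set monoid" where
  "free_group = \<lparr>carrier = UNIV // free_equiv,
     monoid.mult = (\<lambda>A B. \<Union>u\<in>A. \<Union>w\<in>B. free_equiv `` {u @ w}),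
     one = free_equiv `` {[]}\<rparr>"

definition free_gen :: "'x \<Rightarrow> 'x word set" where
  "free_gen x = free_equiv `` {[(x, True)]}"

definition normal_closure :: "('a, 'b) monoid_scheme \<Rightarrow> 'a set \<Rightarrow> 'a set" where
  "normal_closure G A = generate G {g \<otimes>\<^bsub>G\<^esub> a \<otimes>\<^bsub>G\<^esub> inv\<^bsub>G\<^esub> g | g a. g \<in> carrier G \<and> a \<in> A}"

text \<open>A relation \<open>l = r\<close> is a pair \<open>(l, r)\<close> of elements of the free group.\<close>

definition presented_group ::
  "('x word set \<times> 'x word set) set \<Rightarrow> 'x word set set monoid" where
  "presented_group R = free_group Mod
     normal_closure free_group {l \<otimes>\<^bsub>free_group\<^esub> inv\<^bsub>free_group\<^esub> r | l r. (l, r) \<in> R}"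

definition presented_gen ::
  "('x word set \<times> 'x word set) set \<Rightarrow> 'x \<Rightarrow> 'x word set set" where
  "presented_gen R x =
     normal_closure free_group {l \<otimes>\<^bsub>free_group\<^esub> inv\<^bsub>free_group\<^esub> r | l r. (l, r) \<in> R}
       #>\<^bsub>free_group\<^esub> free_gen x"

text \<open>All elements of the type \<open>'x\<close> are generators. The isomorphism has to be the
  canonical one, sending the generator \<open>x\<close> to \<open>f x\<close>.\<close>

definition is_presented_by ::
  "('a, 'b) monoid_scheme \<Rightarrow> ('x \<Rightarrow> 'a) \<Rightarrow> ('x word set \<times> 'x word set) set \<Rightarrow> bool" where
  "is_presented_by G f R \<longleftrightarrow>
     group G \<and> (\<exists>\<phi> \<in> iso (presented_group R) G. \<forall>x. \<phi> (presented_gen R x) = f x)"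

type_synonym point = "real \<times> real"

fun cantor_approx :: "nat \<Rightarrow> real set" where
  "cantor_approx 0 = {0..1}"
| "cantor_approx (Suc n) =
     (\<lambda>x. x / 3) ` cantor_approx n \<union> (\<lambda>x. 2 / 3 + x / 3) ` cantor_approx n"

definition Cantor :: "real set" where
  "Cantor = (\<Inter>n. cantor_approx n)"

definition Y :: "point set" where
  "Y = (\<Union>i::nat. ((\<lambda>x. 2 * real i + x) ` Cantor) \<times> Cantor)"

definition Sq :: "nat \<Rightarrow> point set" where
  "Sq i = {2 * real i .. 2 * real i + 1} \<times> {0..1}"

inductive pattern :: "point set set \<Rightarrow> bool" where
  trivial: "pattern (range Sq)"
| vertical: "\<lbrakk>pattern \<P>; {a..b} \<times> {c..d} \<in> \<P>\<rbrakk> \<Longrightarrow>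
    pattern ((\<P> - {{a..b} \<times> {c..d}}) \<union>
      {{a .. a + (b - a) / 3} \<times> {c..d}, {b - (b - a) / 3 .. b} \<times> {c..d}})"
| horizontal: "\<lbrakk>pattern \<P>; {a..b} \<times> {c..d} \<in> \<P>\<rbrakk> \<Longrightarrow>
    pattern ((\<P> - {{a..b} \<times> {c..d}}) \<union>
      {{a..b} \<times> {c .. c + (d - c) / 3}, {a..b} \<times> {d - (d - c) / 3 .. d}})"

definition numbered_pattern :: "(nat \<Rightarrow> point set) \<Rightarrow> bool" where
  "numbered_pattern P \<longleftrightarrow>
     (\<exists>\<P>. pattern \<P> \<and> bij_betw P UNIV \<P> \<and>
       (\<exists>j k. \<forall>i>k. {R \<in> \<P>. R \<subseteq> Sq i} = {P (i + j)}))"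

text \<open>Homeomorphisms of \<open>Y\<close> are represented by functions that are \<open>undefined\<close> outside \<open>Y\<close>,
  as in \<^const>\<open>BijGroup\<close>. No continuity condition is needed: the maps are affine on
  each set \<open>Y \<inter> Q i\<close>, and these sets form a locally finite partition of \<open>Y\<close> into clopen
  pieces.\<close>

definition pair_map ::
  "(nat \<Rightarrow> point set) \<Rightarrow> (nat \<Rightarrow> point set) \<Rightarrow> point \<Rightarrow> point" where
  "pair_map P Q = (THE \<phi>. \<phi> \<in> extensional Y \<and>
     (\<forall>i. \<phi> ` (Y \<inter> Q i) = Y \<inter> P i \<and>
       (\<exists>a b. \<exists>j k :: int. \<forall>x y. (x, y) \<in> Y \<inter> Q i \<longrightarrow>
          \<phi> (x, y) = (a + 3 powi j * x, b + 3 powi k * y))))"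

definition hat2V :: "(point \<Rightarrow> point) monoid" where
  "hat2V = (BijGroup Y)\<lparr>carrier :=
     {pair_map P Q | P Q. numbered_pattern P \<and> numbered_pattern Q}\<rparr>"

definition elt :: "(nat \<Rightarrow> point set) \<Rightarrow> point \<Rightarrow> point" where
  "elt P = pair_map P Sq"

definition v_pattern :: "nat \<Rightarrow> nat \<Rightarrow> point set" where
  "v_pattern i n =
    (if n < i then Sq n
     else if n = i then {2 * real i .. 2 * real i + 1 / 3} \<times> {0..1}
     else if n = i + 1 then {2 * real i + 2 / 3 .. 2 * real i + 1} \<times> {0..1}
     else Sq (n - 1))"

definition h_pattern :: "nat \<Rightarrow> nat \<Rightarrow> point set" where
  "h_pattern i n =
    (if n < i then Sq n
     else if n = i then {2 * real i .. 2 * real i + 1} \<times> {0 .. 1 / 3}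
     else if n = i + 1 then {2 * real i .. 2 * real i + 1} \<times> {2 / 3 .. 1}
     else Sq (n - 1))"

definition \<sigma>_pattern :: "nat \<Rightarrow> nat \<Rightarrow> point set" where
  "\<sigma>_pattern i n = (if n = i then Sq (i + 1) else if n = i + 1 then Sq i else Sq n)"

datatype gen = V0 | V1 | H0 | H1 | S0 | S1

text \<open>\<open>S0\<close> and \<open>S1\<close> are the letters for \<open>\<sigma>\<close>.\<close>

primrec gen_elt :: "gen \<Rightarrow> point \<Rightarrow> point" where
  "gen_elt V0 = elt (v_pattern 0)"
| "gen_elt V1 = elt (v_pattern 1)"
| "gen_elt H0 = elt (h_pattern 0)"
| "gen_elt H1 = elt (h_pattern 1)"
| "gen_elt S0 = elt (\<sigma>_pattern 0)"
| "gen_elt S1 = elt (\<sigma>_pattern 1)"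

definition symbol :: "gen \<Rightarrow> gen \<Rightarrow> nat \<Rightarrow> gen word set" where
  "symbol x0 x1 i =
    (if i = 0 then free_gen x0
     else if i = 1 then free_gen x1
     else free_gen V0 [^]\<^bsub>free_group\<^esub> (1 - int i) \<otimes>\<^bsub>free_group\<^esub> free_gen x1
            \<otimes>\<^bsub>free_group\<^esub> free_gen V0 [^]\<^bsub>free_group\<^esub> (int i - 1))"

text \<open>Elements of the free group, not of \<^const>\<open>hat2V\<close>.\<close>

definition v :: "nat \<Rightarrow> gen word set" where "v = symbol V0 V1"
definition h :: "nat \<Rightarrow> gen word set" where "h = symbol H0 H1"
definition \<sigma> :: "nat \<Rightarrow> gen word set" where "\<sigma> = symbol S0 S1"

abbreviation free_mult :: "gen word set \<Rightarrow> gen word set \<Rightarrow> gen word set"  (infixl \<open>\<cdot>\<close> 70) where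
  "a \<cdot> b \<equiv> a \<otimes>\<^bsub>free_group\<^esub> b"

definition relations :: "(gen word set \<times> gen word set) set" where
  "relations = {
     (v 2 \<cdot> v 1, v 1 \<cdot> v 3), (v 3 \<cdot> v 1, v 1 \<cdot> v 4),
     (h 2 \<cdot> v 1, v 1 \<cdot> h 3), (h 3 \<cdot> v 1, v 1 \<cdot> h 4),
     (v 1 \<cdot> h 0, h 0 \<cdot> v 2), (v 2 \<cdot> h 0, h 0 \<cdot> v 3),
     (v 2 \<cdot> h 1, h 1 \<cdot> v 3), (v 3 \<cdot> h 1, h 1 \<cdot> v 4),
     (h 1 \<cdot> h 0, h 0 \<cdot> h 2), (h 2 \<cdot> h 0, h 0 \<cdot> h 3),
     (h 2 \<cdot> h 1, h 1 \<cdot> h 3), (h 3 \<cdot> h 1, h 1 \<cdot> h 4),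
     (\<sigma> 0 \<cdot> v 2, v 2 \<cdot> \<sigma> 0), (\<sigma> 0 \<cdot> v 3, v 3 \<cdot> \<sigma> 0),
     (\<sigma> 1 \<cdot> v 3, v 3 \<cdot> \<sigma> 1), (\<sigma> 1 \<cdot> v 4, v 4 \<cdot> \<sigma> 1),
     (\<sigma> 0 \<cdot> h 2, h 2 \<cdot> \<sigma> 0), (\<sigma> 0 \<cdot> h 3, h 3 \<cdot> \<sigma> 0),
     (\<sigma> 1 \<cdot> h 3, h 3 \<cdot> \<sigma> 1), (\<sigma> 1 \<cdot> h 4, h 4 \<cdot> \<sigma> 1),
     (\<sigma> 0 \<cdot> v 0, v 1 \<cdot> \<sigma> 0 \<cdot> \<sigma> 1), (\<sigma> 1 \<cdot> v 1, v 2 \<cdot> \<sigma> 1 \<cdot> \<sigma> 2),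
     (\<sigma> 0 \<cdot> h 0, h 1 \<cdot> \<sigma> 0 \<cdot> \<sigma> 1), (\<sigma> 1 \<cdot> h 1, h 2 \<cdot> \<sigma> 1 \<cdot> \<sigma> 2),
     (\<sigma> 1 \<cdot> h 0, h 0 \<cdot> \<sigma> 2), (\<sigma> 2 \<cdot> h 0, h 0 \<cdot> \<sigma> 3),
     (\<sigma> 2 \<cdot> h 1, h 1 \<cdot> \<sigma> 3), (\<sigma> 3 \<cdot> h 1, h 1 \<cdot> \<sigma> 4),
     (\<sigma> 2 \<cdot> v 1, v 1 \<cdot> \<sigma> 3), (\<sigma> 3 \<cdot> v 1, v 1 \<cdot> \<sigma> 4),
     (\<sigma> 0 \<cdot> \<sigma> 0, \<one>\<^bsub>free_group\<^esub>), (\<sigma> 1 \<cdot> \<sigma> 1, \<one>\<^bsub>free_group\<^esub>),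
     (\<sigma> 0 \<cdot> \<sigma> 2, \<sigma> 2 \<cdot> \<sigma> 0), (\<sigma> 0 \<cdot> \<sigma> 3, \<sigma> 3 \<cdot> \<sigma> 0),
     (\<sigma> 1 \<cdot> \<sigma> 3, \<sigma> 3 \<cdot> \<sigma> 1), (\<sigma> 1 \<cdot> \<sigma> 4, \<sigma> 4 \<cdot> \<sigma> 1),
     (\<sigma> 0 \<cdot> \<sigma> 1 \<cdot> \<sigma> 0, \<sigma> 1 \<cdot> \<sigma> 0 \<cdot> \<sigma> 1), (\<sigma> 1 \<cdot> \<sigma> 2 \<cdot> \<sigma> 1, \<sigma> 2 \<cdot> \<sigma> 1 \<cdot> \<sigma> 2),
     (v 0 \<cdot> h 1 \<cdot> h 0, h 0 \<cdot> v 1 \<cdot> v 0 \<cdot> \<sigma> 1),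
     (v 1 \<cdot> h 2 \<cdot> h 1, h 1 \<cdot> v 2 \<cdot> v 1 \<cdot> \<sigma> 2)}"

end

theory Submission
  imports Defs "HOL-Combinatorics.Permutations"
begin

text \<open>
  The argument separates three things: a monoid in which everything can be computed, its geometric
  meaning, and the arithmetic of the abstract group.

  A numbered pattern is encoded by the function \<open>nat \<Rightarrow> address\<close> that gives, for each number, the
  square containing the rectangle with this number and the ternary digits (left or right third,
  bottom or top third) that locate it there. Such functions form a monoid under substitution, and
  \<open>act\<close> turns them into self-maps of \<^const>\<open>Y\<close>. The numbered patterns are exactly the products of
  the cuts \<open>v\<^sub>i\<close>, \<open>h\<^sub>i\<close> and the swaps \<open>\<sigma>\<^sub>i\<close> (\<open>pattern_numbering\<close>, \<open>numbered_pattern_numbering\<close>), and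
  the homeomorphism of a pair \<open>(P, Q)\<close> is \<open>P Q\<^sup>-\<^sup>1\<close> (\<open>pair_map_numbering\<close>).

  In the presented group, conjugation by \<open>v\<^sub>0\<close> raises the positive indices, so the finite list of relations
  yields the corresponding infinite families for all indices (locale \<open>brin_presentation\<close>, which
  becomes an instance of \<open>numbering_monoid\<close>). Call a product of generators \<open>v\<^sub>i\<close>, \<open>h\<^sub>i\<close>, \<open>\<sigma>\<^sub>i\<close>
  without inverses positive. Two facts then finish the proof.

  First, every element of the group is a quotient \<open>p q\<^sup>-\<^sup>1\<close> of positive elements
  (\<open>fraction_inv_gen\<close>). It suffices that each positive element has a common right multiple with each
  cut; the multiple is found by cutting all rectangles with a small number once more in the wanted
  direction (\<open>common_multiple\<close>).

  Secondly, positive elements with the same numbered pattern are equal (\<open>positive_unique\<close>). If the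
  pattern cuts the square \<open>S\<^sub>i\<close> all the way through in direction \<open>d\<close>, then this cut can be moved to
  the front of any positive word for it (\<open>divided_cut_first\<close>). When the word starts by cutting
  \<open>S\<^sub>i\<close> in the other direction, both halves are cut through in direction \<open>d\<close>, so by induction the
  word continues with these two cuts, and the relation \<open>v\<^sub>i h\<^sub>i\<^sub>+\<^sub>1 h\<^sub>i = h\<^sub>i v\<^sub>i\<^sub>+\<^sub>1 v\<^sub>i \<sigma>\<^sub>i\<^sub>+\<^sub>1\<close> exchanges
  the two orders of cutting into quarters. Two words with the same pattern can thus be made to
  start with the same cut, which cancels; in the end only products of swaps are left, where the
  relations are the Coxeter relations of the finitary symmetric group (\<open>swaps_unique\<close>).

  An element \<open>p q\<^sup>-\<^sup>1\<close> of the presented group that acts trivially on \<^const>\<open>Y\<close> has \<open>p\<close> and \<open>q\<close> with the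
  same pattern, hence \<open>p = q\<close>. So the kernel of the map from the free group is the normal closure
  of the relators, and its image is the set of all pair maps.
\<close>

section \<open>Free groups and presented groups\<close>

lemma free_equiv_refl: "(u, u) \<in> free_equiv"
  unfolding free_equiv_def by simp

lemma sym_free_equiv: "sym free_equiv"
  unfolding free_equiv_def by (rule sym_rtrancl) (auto simp: sym_def)

lemma trans_free_equiv: "trans free_equiv"
  unfolding free_equiv_def by (rule trans_rtrancl)

lemma equiv_free_equiv: "equiv UNIV free_equiv"
  by (rule equivI) (simp_all add: refl_on_def free_equiv_refl sym_free_equiv trans_free_equiv)

lemma free_equiv_context:
  assumes "(u, w) \<in> free_equiv"
  shows "(p @ u @ q, p @ w @ q) \<in> free_equiv"
  using assms unfolding free_equiv_def
proof (induction rule: rtrancl_induct)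
  case (step y z)
  have closed: "(p @ a @ q, p @ b @ q) \<in> cancellation" if cancel: "(a, b) \<in> cancellation"
    for a b :: "'a word"
  proof -
    from cancel obtain u x c w where "a = u @ [(x, c), (x, \<not> c)] @ w" "b = u @ w"
      unfolding cancellation_def by blast
    then have "p @ a @ q = (p @ u) @ [(x, c), (x, \<not> c)] @ (w @ q)"
      "p @ b @ q = (p @ u) @ (w @ q)" by simp_all
    then show ?thesis unfolding cancellation_def by blast
  qed
  have "(p @ y @ q, p @ z @ q) \<in> cancellation \<union> cancellation\<inverse>"
    using step.hyps(2) closed by blast
  with step.IH show ?case by (rule rtrancl.rtrancl_into_rtrancl)
qed simp

lemma free_equiv_append:
  assumes "(u, u') \<in> free_equiv" "(w, w') \<in> free_equiv"
  shows "(u @ w, u' @ w') \<in> free_equiv"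
  using transD[OF trans_free_equiv, of "u @ w" "u' @ w" "u' @ w'"]
    free_equiv_context[OF assms(1), of "[]" w] free_equiv_context[OF assms(2), of u' "[]"]
  by simp

abbreviation word_class :: "'x word \<Rightarrow> 'x word set" where
  "word_class w \<equiv> free_equiv `` {w}"

lemma word_class_eq_iff: "word_class u = word_class w \<longleftrightarrow> (u, w) \<in> free_equiv"
  using eq_equiv_class_iff[OF equiv_free_equiv] by simp

lemma carrier_free_group: "carrier free_group = range word_class"
  by (auto simp: free_group_def quotient_def)

lemma mult_word_class:
  "word_class u \<otimes>\<^bsub>free_group\<^esub> word_class w = word_class (u @ w)"
proof -
  have "word_class (u' @ w') = word_class (u @ w)"
    if "u' \<in> word_class u" "w' \<in> word_class w" for u' w'
    using that free_equiv_append[of u u' w w'] by (simp add: word_class_eq_iff symD[OF sym_free_equiv])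
  then have "(\<Union>u'\<in>word_class u. \<Union>w'\<in>word_class w. word_class (u' @ w'))
      = (\<Union>u'\<in>word_class u. \<Union>w'\<in>word_class w. word_class (u @ w))"
    by (intro SUP_cong refl)
  also have "\<dots> = word_class (u @ w)"
    using free_equiv_refl[of u] free_equiv_refl[of w] by auto
  finally show ?thesis by (simp add: free_group_def)
qed

lemma one_free_group: "\<one>\<^bsub>free_group\<^esub> = word_class []"
  by (simp add: free_group_def)

lemma cancel_free_equiv: "([(x, b), (x, \<not> b)], []) \<in> free_equiv"
proof -
  have "([] @ [(x, b), (x, \<not> b)] @ [], [] @ []) \<in> cancellation"
    unfolding cancellation_def by blast
  then show ?thesis unfolding free_equiv_def by auto
qed

lemma inverse_word: "(rev (map (\<lambda>(x, b). (x, \<not> b)) w) @ w, []) \<in> free_equiv"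
proof (induction w)
  case (Cons y w)
  obtain x b where y: "y = (x, b)" by (cases y)
  let ?r = "rev (map (\<lambda>(x, b). (x, \<not> b)) w)"
  have "(?r @ [(x, \<not> b), (x, \<not> \<not> b)] @ w, ?r @ [] @ w) \<in> free_equiv"
    by (rule free_equiv_context[OF cancel_free_equiv])
  then have "(?r @ [(x, \<not> b), (x, \<not> \<not> b)] @ w, []) \<in> free_equiv"
    using Cons.IH transD[OF trans_free_equiv] by fastforce
  then show ?case using y by simp
qed (simp add: free_equiv_refl)

lemma group_free_group: "group free_group"
proof (rule groupI)
  show "\<exists>B\<in>carrier free_group. B \<otimes>\<^bsub>free_group\<^esub> A = \<one>\<^bsub>free_group\<^esub>"
    if inA: "A \<in> carrier free_group" for A :: "'a word set"
  proof -
    from inA obtain w where "A = word_class w" by (auto simp: carrier_free_group)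
    then show ?thesis
      using inverse_word[of w]
      by (auto simp: carrier_free_group mult_word_class one_free_group word_class_eq_iff)
  qed
qed (auto simp: carrier_free_group mult_word_class one_free_group)

lemma free_gen_closed: "free_gen x \<in> carrier free_group"
  by (simp add: free_gen_def carrier_free_group)

lemma inv_free_gen: "inv\<^bsub>free_group\<^esub> free_gen x = word_class [(x, False)]"
  by (rule group.inv_equality[OF group_free_group])
    (use cancel_free_equiv[of x False] in \<open>auto simp: free_gen_def mult_word_class one_free_group
      word_class_eq_iff carrier_free_group\<close>)

text \<open>Multiplying on the left by generators and their inverses reaches every element.\<close>

lemma free_group_induct [consumes 1, case_names one gen inv_gen]:
  assumes "g \<in> carrier free_group"
    and one: "Q \<one>\<^bsub>free_group\<^esub>"
    and gen: "\<And>x g. \<lbrakk>g \<in> carrier free_group; Q g\<rbrakk> \<Longrightarrow> Q (free_gen x \<otimes>\<^bsub>free_group\<^esub> g)"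
    and inv: "\<And>x g. \<lbrakk>g \<in> carrier free_group; Q g\<rbrakk>
      \<Longrightarrow> Q (inv\<^bsub>free_group\<^esub> free_gen x \<otimes>\<^bsub>free_group\<^esub> g)"
  shows "Q g"
proof -
  have "Q (word_class w)" for w
  proof (induction w)
    case Nil
    then show ?case using one by (simp add: one_free_group)
  next
    case (Cons y w)
    have "word_class w \<in> carrier free_group" by (simp add: carrier_free_group)
    then show ?case
      using gen[OF _ Cons.IH, of "fst y"] inv[OF _ Cons.IH, of "fst y"]
      by (cases y; cases "snd y") (auto simp: inv_free_gen[unfolded free_gen_def] free_gen_def mult_word_class)
  qed
  with assms(1) show ?thesis by (auto simp: carrier_free_group)
qed

fun word_value :: "('a, 'b) monoid_scheme \<Rightarrow> ('x \<Rightarrow> 'a) \<Rightarrow> 'x word \<Rightarrow> 'a" where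
  "word_value G f [] = \<one>\<^bsub>G\<^esub>"
| "word_value G f ((x, b) # w) = (if b then f x else inv\<^bsub>G\<^esub> f x) \<otimes>\<^bsub>G\<^esub> word_value G f w"

lemma free_group_extension:
  assumes "group G" and f: "\<And>x. f x \<in> carrier G"
  obtains \<theta> where "\<theta> \<in> hom free_group G" "\<And>x. \<theta> (free_gen x) = f x"
proof -
  interpret group G by fact
  have closed [simp]: "word_value G f w \<in> carrier G" for w
  proof (induction w)
    case (Cons y w)
    then show ?case by (cases y) (simp add: f)
  qed simp
  have append: "word_value G f (u @ w) = word_value G f u \<otimes>\<^bsub>G\<^esub> word_value G f w" for u w
  proof (induction u)
    case (Cons y u)
    then show ?case by (cases y) (simp add: m_assoc f)
  qed simp
  have cancel: "word_value G f [(x, b), (x, \<not> b)] = \<one>\<^bsub>G\<^esub>" for x b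
    by (cases b) (simp_all add: f)
  have step: "word_value G f u = word_value G f w" if "(u, w) \<in> cancellation" for u w
  proof -
    from that obtain v x b q where "u = v @ [(x, b), (x, \<not> b)] @ q" "w = v @ q"
      unfolding cancellation_def by blast
    then show ?thesis by (simp only: append cancel closed l_one)
  qed
  have value_eq: "word_value G f u = word_value G f w" if "(u, w) \<in> free_equiv" for u w
    using that unfolding free_equiv_def by (induction rule: rtrancl_induct) (auto dest: step)
  define \<theta> where "\<theta> A = word_value G f (SOME w. w \<in> A)" for A
  have \<theta>: "\<theta> (word_class w) = word_value G f w" for w
  proof -
    have "(SOME u. u \<in> word_class w) \<in> word_class w"
      by (rule someI[of _ w]) (simp add: free_equiv_refl)
    then show ?thesis unfolding \<theta>_def using value_eq by force
  qed
  show thesis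
  proof
    show "\<theta> \<in> hom free_group G"
      by (auto simp: hom_def carrier_free_group mult_word_class \<theta> append)
    show "\<theta> (free_gen x) = f x" for x by (simp add: free_gen_def \<theta> f)
  qed
qed

lemma (in group) normal_closure_normal:
  assumes "A \<subseteq> carrier G"
  shows "normal_closure G A \<lhd> G"
  unfolding normal_closure_def
proof (rule normal_generateI)
  show "{g \<otimes> a \<otimes> inv g | g a. g \<in> carrier G \<and> a \<in> A} \<subseteq> carrier G"
    using assms by auto
  fix z g
  assume "z \<in> {g \<otimes> a \<otimes> inv g | g a. g \<in> carrier G \<and> a \<in> A}" and g: "g \<in> carrier G"
  then obtain k a where z: "z = k \<otimes> a \<otimes> inv k" "k \<in> carrier G" "a \<in> A" by blast
  have a: "a \<in> carrier G" using z assms by blast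
  have "g \<otimes> z \<otimes> inv g = (g \<otimes> k) \<otimes> a \<otimes> inv (g \<otimes> k)"
    using z g a by (simp add: m_assoc inv_mult_group)
  then show "g \<otimes> z \<otimes> inv g \<in> {g \<otimes> a \<otimes> inv g | g a. g \<in> carrier G \<and> a \<in> A}"
    using z g by blast
qed

lemma (in group) normal_closure_incl:
  assumes "A \<subseteq> carrier G" "a \<in> A"
  shows "a \<in> normal_closure G A"
proof -
  have "a = \<one> \<otimes> a \<otimes> inv \<one>" using assms by auto
  then show ?thesis unfolding normal_closure_def using assms(2) by (intro generate.incl) blast
qed

definition relators :: "('x word set \<times> 'x word set) set \<Rightarrow> 'x word set set" where
  "relators R = {l \<otimes>\<^bsub>free_group\<^esub> inv\<^bsub>free_group\<^esub> r | l r. (l, r) \<in> R}"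

lemma relators_closed:
  assumes "R \<subseteq> carrier free_group \<times> carrier free_group"
  shows "relators R \<subseteq> carrier free_group"
proof -
  interpret F: group free_group by (rule group_free_group)
  show ?thesis using assms unfolding relators_def by blast
qed

text \<open>Both sides of a relation become equal in the quotient: this is how the relations enter the
  presented group.\<close>

lemma presented_group_relation:
  assumes "R \<subseteq> carrier free_group \<times> carrier free_group" "(l, r) \<in> R"
  shows "normal_closure free_group (relators R) #>\<^bsub>free_group\<^esub> l
       = normal_closure free_group (relators R) #>\<^bsub>free_group\<^esub> r"
proof -
  interpret F: group free_group by (rule group_free_group)
  interpret N: normal "normal_closure free_group (relators R)" free_group
    by (rule F.normal_closure_normal[OF relators_closed[OF assms(1)]])
  have lr: "l \<in> carrier free_group" "r \<in> carrier free_group" using assms by auto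
  have "l \<otimes>\<^bsub>free_group\<^esub> inv\<^bsub>free_group\<^esub> r \<in> normal_closure free_group (relators R)"
    using assms by (intro F.normal_closure_incl relators_closed) (auto simp: relators_def)
  moreover have "l = (l \<otimes>\<^bsub>free_group\<^esub> inv\<^bsub>free_group\<^esub> r) \<otimes>\<^bsub>free_group\<^esub> r"
    using lr by (simp add: F.m_assoc)
  ultimately have "l \<in> normal_closure free_group (relators R) #>\<^bsub>free_group\<^esub> r"
    unfolding r_coset_def by blast
  then show ?thesis using F.repr_independence[OF _ _ N.subgroup_axioms] lr by metis
qed

text \<open>The kernel is a normal subgroup, and the relators lie in it because the relations hold in the
  image.\<close>

lemma normal_closure_subset_kernel:
  assumes "group H" and \<theta>: "\<theta> \<in> hom free_group H"
    and R: "R \<subseteq> carrier free_group \<times> carrier free_group"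
    and holds: "\<And>l r. (l, r) \<in> R \<Longrightarrow> \<theta> l = \<theta> r"
  shows "normal_closure free_group (relators R) \<subseteq> kernel free_group H \<theta>"
proof -
  interpret F: group free_group by (rule group_free_group)
  interpret H: group H by fact
  interpret \<theta>: group_hom free_group H \<theta> by (unfold_locales) (rule \<theta>)
  have relators: "relators R \<subseteq> carrier free_group" by (rule relators_closed[OF R])
  have "\<theta> (g \<otimes>\<^bsub>free_group\<^esub> a \<otimes>\<^bsub>free_group\<^esub> inv\<^bsub>free_group\<^esub> g) = \<one>\<^bsub>H\<^esub>"
    if "g \<in> carrier free_group" "a \<in> relators R" for g a
  proof -
    from that obtain l r where a: "a = l \<otimes>\<^bsub>free_group\<^esub> inv\<^bsub>free_group\<^esub> r" "(l, r) \<in> R"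
      by (auto simp: relators_def)
    then have lr: "l \<in> carrier free_group" "r \<in> carrier free_group" using R by auto
    have "\<theta> a = \<one>\<^bsub>H\<^esub>" using holds[OF a(2)] a(1) lr by simp
    moreover have "a \<in> carrier free_group" using that(2) relators by blast
    ultimately show ?thesis using that(1) by simp
  qed
  then show ?thesis
    unfolding normal_closure_def using relators
    by (intro F.generate_subgroup_incl \<theta>.subgroup_kernel) (fastforce simp: kernel_def)
qed

text \<open>The kernel always contains the normal closure of the relators, so the first isomorphism theorem
  applies as soon as it is no larger. The target is cut down to the image, so surjectivity is
  automatic and the group in question only has to be identified as a subset of \<open>H\<close>.\<close>

lemma is_presented_byI:
  assumes "group H" and \<theta>: "\<theta> \<in> hom free_group H" and gens: "\<And>x. \<theta> (free_gen x) = f x"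
    and R: "R \<subseteq> carrier free_group \<times> carrier free_group"
    and holds: "\<And>l r. (l, r) \<in> R \<Longrightarrow> \<theta> l = \<theta> r"
    and kernel: "\<And>g. \<lbrakk>g \<in> carrier free_group; \<theta> g = \<one>\<^bsub>H\<^esub>\<rbrakk>
      \<Longrightarrow> g \<in> normal_closure free_group (relators R)"
  shows "is_presented_by (H\<lparr>carrier := \<theta> ` carrier free_group\<rparr>) f R"
proof -
  interpret F: group free_group by (rule group_free_group)
  interpret H: group H by fact
  interpret \<theta>: group_hom free_group H \<theta> by (unfold_locales) (rule \<theta>)
  let ?I = "H\<lparr>carrier := \<theta> ` carrier free_group\<rparr>"
  let ?N = "normal_closure free_group (relators R)"
  interpret I: group ?I
    using subgroup.subgroup_is_group[OF \<theta>.img_is_subgroup \<open>group H\<close>] .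
  interpret \<theta>I: group_hom free_group ?I \<theta>
    by unfold_locales (auto simp: hom_def)
  have relators: "relators R \<subseteq> carrier free_group" by (rule relators_closed[OF R])
  interpret N: normal ?N free_group by (rule F.normal_closure_normal[OF relators])
  have N_kernel: "?N \<subseteq> kernel free_group H \<theta>"
    using normal_closure_subset_kernel[OF \<open>group H\<close> \<theta> R holds] .
  moreover have "kernel free_group H \<theta> \<subseteq> ?N" using kernel by (auto simp: kernel_def)
  ultimately have N: "?N = kernel free_group ?I \<theta>" by (simp add: kernel_def)
  let ?\<phi> = "\<lambda>X. the_elem (\<theta> ` X)"
  have "?\<phi> \<in> iso (presented_group R) ?I"
    unfolding presented_group_def relators_def[symmetric] N by (rule \<theta>I.FactGroup_iso_set) simp
  moreover have "?\<phi> (presented_gen R x) = f x" for x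
  proof -
    have "\<theta> ` (?N #>\<^bsub>free_group\<^esub> free_gen x) = {f x}"
    proof
      show "\<theta> ` (?N #>\<^bsub>free_group\<^esub> free_gen x) \<subseteq> {f x}"
      proof (clarsimp simp: r_coset_def)
        fix a assume "a \<in> ?N"
        then have "a \<in> carrier free_group" "\<theta> a = \<one>\<^bsub>H\<^esub>"
          using N_kernel by (auto simp: kernel_def)
        then show "\<theta> (a \<otimes>\<^bsub>free_group\<^esub> free_gen x) = f x"
          using \<theta>.hom_closed[OF free_gen_closed[of x]] by (simp add: free_gen_closed gens)
      qed
      have "\<one>\<^bsub>free_group\<^esub> \<otimes>\<^bsub>free_group\<^esub> free_gen x \<in> ?N #>\<^bsub>free_group\<^esub> free_gen x"
        using N.one_closed unfolding r_coset_def by blast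
      then have "free_gen x \<in> ?N #>\<^bsub>free_group\<^esub> free_gen x" by (simp add: free_gen_closed)
      then have "\<theta> (free_gen x) \<in> \<theta> ` (?N #>\<^bsub>free_group\<^esub> free_gen x)" by (rule imageI)
      then show "{f x} \<subseteq> \<theta> ` (?N #>\<^bsub>free_group\<^esub> free_gen x)" by (simp only: gens) simp
    qed
    then show ?thesis unfolding presented_gen_def relators_def[symmetric] by simp
  qed
  ultimately show ?thesis
    unfolding is_presented_by_def by (intro conjI I.is_group bexI[of _ ?\<phi>] allI)
qed

section \<open>The infinite presentation\<close>

text \<open>The letters \<open>v\<close>, \<open>h\<close>, \<open>\<sigma>\<close> are handled as a single family indexed by \<^typ>\<open>bool option\<close>, since most
  relations do not distinguish them: \<^term>\<open>Some True\<close> stands for the vertical cuts, \<^term>\<open>Some False\<close>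
  for the horizontal cuts and \<^term>\<open>None\<close> for the swaps. Only a monoid is required, so that the same
  locale covers the presented group, the monoid of numberings and the product of the two. Products
  are bracketed to the right, as needed for rewriting.\<close>

locale numbering_monoid = monoid K for K (structure) +
  fixes z :: "bool option \<Rightarrow> nat \<Rightarrow> 'a"
  assumes z_closed [simp]: "z k i \<in> carrier K"
    and commute: "i < j \<Longrightarrow> z k j \<otimes> z (Some d) i = z (Some d) i \<otimes> z k (Suc j)"
    and far: "Suc i < j \<Longrightarrow> z None i \<otimes> z k j = z k j \<otimes> z None i"
    and turn: "z None i \<otimes> z (Some d) i = z (Some d) (Suc i) \<otimes> (z None i \<otimes> z None (Suc i))"
    and square: "z None i \<otimes> z None i = \<one>"
    and braid: "z None i \<otimes> (z None (Suc i) \<otimes> z None i)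
      = z None (Suc i) \<otimes> (z None i \<otimes> z None (Suc i))"
    and cross: "z (Some True) i \<otimes> (z (Some False) (Suc i) \<otimes> z (Some False) i)
      = z (Some False) i \<otimes> (z (Some True) (Suc i) \<otimes> (z (Some True) i \<otimes> z None (Suc i)))"
begin

abbreviation x :: "bool \<Rightarrow> nat \<Rightarrow> 'a" where "x d \<equiv> z (Some d)"
abbreviation s :: "nat \<Rightarrow> 'a" where "s \<equiv> z None"

text \<open>The first argument counts the cuts. The main induction is on this number, which swaps do not
  change.\<close>

inductive positive :: "nat \<Rightarrow> 'a \<Rightarrow> bool" where
  one: "positive 0 \<one>"
| swap: "positive n g \<Longrightarrow> positive n (s i \<otimes> g)"
| cut: "positive n g \<Longrightarrow> positive (Suc n) (x d i \<otimes> g)"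

lemma positive_closed [simp]: "positive n g \<Longrightarrow> g \<in> carrier K"
  by (induction rule: positive.induct) auto

lemma positive_mult: "positive n g \<Longrightarrow> positive m g' \<Longrightarrow> positive (n + m) (g \<otimes> g')"
  by (induction rule: positive.induct) (auto simp: m_assoc intro: positive.intros)

lemma positive_s: "positive 0 (s i)"
  using positive.swap[OF positive.one, of i] by simp

lemma positive_x: "positive 1 (x d i)"
  using positive.cut[OF positive.one, of d i] by simp

lemma positive_s_left: "positive 0 w \<Longrightarrow> positive n g \<Longrightarrow> positive n (w \<otimes> g)"
  using positive_mult[of 0 w n g] by simp

lemma positive_gen_left: "positive n g \<Longrightarrow> \<exists>m. positive m (z k i \<otimes> g)"
  by (cases k) (auto intro: positive.intros)

lemma commute': "i < j \<Longrightarrow> g \<in> carrier K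
    \<Longrightarrow> z k j \<otimes> (x d i \<otimes> g) = x d i \<otimes> (z k (Suc j) \<otimes> g)"
  by (simp add: commute m_assoc[symmetric])

lemma far': "Suc i < j \<Longrightarrow> g \<in> carrier K \<Longrightarrow> s i \<otimes> (z k j \<otimes> g) = z k j \<otimes> (s i \<otimes> g)"
  by (simp add: far m_assoc[symmetric])

lemma square': "g \<in> carrier K \<Longrightarrow> s i \<otimes> (s i \<otimes> g) = g"
  by (simp add: square m_assoc[symmetric])

lemma turn': "g \<in> carrier K
    \<Longrightarrow> s i \<otimes> (x d i \<otimes> g) = x d (Suc i) \<otimes> (s i \<otimes> (s (Suc i) \<otimes> g))"
  using turn[of i d] by (simp add: m_assoc[symmetric])

lemma braid': "g \<in> carrier K
    \<Longrightarrow> s i \<otimes> (s (Suc i) \<otimes> (s i \<otimes> g)) = s (Suc i) \<otimes> (s i \<otimes> (s (Suc i) \<otimes> g))"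
  using braid[of i] by (simp add: m_assoc[symmetric])

text \<open>The inverse form of the relation \<open>turn\<close>: a swap is its own inverse.\<close>

lemma turn_back:
  assumes [simp]: "g \<in> carrier K"
  shows "s i \<otimes> (x d (Suc i) \<otimes> g) = x d i \<otimes> (s (Suc i) \<otimes> (s i \<otimes> g))"
proof -
  have "x d (Suc i) \<otimes> g = s i \<otimes> (x d i \<otimes> (s (Suc i) \<otimes> (s i \<otimes> g)))"
    by (simp add: turn' square')
  then show ?thesis by (simp add: square')
qed

text \<open>The relation \<open>cross\<close> is symmetric in the two directions because \<open>\<sigma>\<^sub>i\<^sub>+\<^sub>1\<close> is an involution.\<close>

lemma cross_gen:
  assumes "d \<noteq> e"
  shows "x d i \<otimes> (x e (Suc i) \<otimes> x e i) = x e i \<otimes> (x d (Suc i) \<otimes> (x d i \<otimes> s (Suc i)))"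
proof (cases d)
  case True
  with assms cross show ?thesis by simp
next
  case False
  have "x True i \<otimes> (x False (Suc i) \<otimes> (x False i \<otimes> s (Suc i)))
      = (x True i \<otimes> (x False (Suc i) \<otimes> x False i)) \<otimes> s (Suc i)"
    by (simp add: m_assoc)
  also have "\<dots> = x False i \<otimes> (x True (Suc i) \<otimes> x True i)"
    by (simp add: cross m_assoc square)
  finally show ?thesis using False assms by simp
qed

lemma cross': "d \<noteq> e \<Longrightarrow> g \<in> carrier K \<Longrightarrow> x d i \<otimes> (x e (Suc i) \<otimes> (x e i \<otimes> g))
    = x e i \<otimes> (x d (Suc i) \<otimes> (x d i \<otimes> (s (Suc i) \<otimes> g)))"
  using cross_gen[of d e i] by (simp add: m_assoc[symmetric])

text \<open>A cut moves to the left of a swap at the cost of a product of swaps; its index changes like the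
  numbers that are exchanged.\<close>

lemma swap_past_cut:
  "\<exists>w. positive 0 w \<and> s j \<otimes> x d (Transposition.transpose j (Suc j) i) = x d i \<otimes> w"
proof -
  consider "i = j" | "i = Suc j" | "i < j" | "Suc j < i" by linarith
  then show ?thesis
  proof cases
    case 1
    then have "s j \<otimes> x d (Transposition.transpose j (Suc j) i) = x d i \<otimes> (s (Suc j) \<otimes> s j)"
      using turn_back[of \<one> j d] by simp
    then show ?thesis by (blast intro: positive_s positive.swap)
  next
    case 2
    then have "s j \<otimes> x d (Transposition.transpose j (Suc j) i) = x d i \<otimes> (s j \<otimes> s (Suc j))"
      using turn[of j d] by simp
    then show ?thesis by (blast intro: positive_s positive.swap)
  next
    case 3
    then show ?thesis using commute[of i j None d] by (auto simp: transpose_def intro: positive_s)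
  next
    case 4
    then show ?thesis using far[of j i "Some d"] by (auto simp: transpose_def intro: positive_s)
  qed
qed

lemma cut_first:
  assumes "positive (Suc n) g"
  obtains d i g' where "positive n g'" "g = x d i \<otimes> g'"
proof -
  have "\<exists>d i g'. positive n g' \<and> g = x d i \<otimes> g'" if "positive m g" "m = Suc n" for m g
    using that
  proof (induction rule: positive.induct)
    case (swap m g j)
    then obtain d i g' where g: "positive n g'" "g = x d i \<otimes> g'" by auto
    let ?i = "Transposition.transpose j (Suc j) i"
    from swap_past_cut[of j d ?i] obtain w where w: "positive 0 w" "s j \<otimes> x d i = x d ?i \<otimes> w"
      by auto
    have "s j \<otimes> g = (s j \<otimes> x d i) \<otimes> g'" using g by (simp add: m_assoc)
    also have "\<dots> = x d ?i \<otimes> (w \<otimes> g')" using g w by (simp add: m_assoc)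
    finally show ?case using positive_s_left[OF w(1) g(1)] by blast
  qed auto
  with assms that show thesis by blast
qed

text \<open>Positive elements are built by multiplying on the left, which changes the squares; geometrically
  it is multiplication on the right that divides the rectangles of a pattern one at a time.\<close>

lemma positive_right_induct [consumes 1, case_names one swap cut]:
  assumes "positive n g" and one: "Q \<one>"
    and swap: "\<And>h n i. \<lbrakk>positive n h; Q h\<rbrakk> \<Longrightarrow> Q (h \<otimes> s i)"
    and cut: "\<And>h n d i. \<lbrakk>positive n h; Q h\<rbrakk> \<Longrightarrow> Q (h \<otimes> x d i)"
  shows "Q g"
proof -
  have "Q (h \<otimes> g)" if "positive m h" "Q h" for m h
    using assms(1) that
  proof (induction arbitrary: m h rule: positive.induct)
    case (swap n g i)
    have "Q ((h \<otimes> s i) \<otimes> g)"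
      using swap.IH[of m "h \<otimes> s i"] positive_mult[OF swap.prems(1) positive_s] swap.prems assms(3)
      by simp
    then show ?case using swap.hyps swap.prems by (simp add: m_assoc)
  next
    case (cut n g d i)
    have "Q ((h \<otimes> x d i) \<otimes> g)"
      using cut.IH[of "m + 1" "h \<otimes> x d i"] positive_mult[OF cut.prems(1) positive_x] cut.prems assms(4)
      by simp
    then show ?case using cut.hyps cut.prems by (simp add: m_assoc)
  qed simp
  from this[OF positive.one one] show ?thesis using assms(1) by simp
qed

subsection \<open>Common multiples\<close>

text \<open>The pattern in which each of the squares \<open>S\<^sub>0\<close>, ..., \<open>S\<^sub>n\<^sub>-\<^sub>1\<close> is cut once in direction \<open>d\<close>. The square
  with the largest number is cut first in the word, so that the numbers of the others stay the same.\<close>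

fun comb :: "bool \<Rightarrow> nat \<Rightarrow> 'a" where
  "comb d 0 = \<one>"
| "comb d (Suc n) = x d n \<otimes> comb d n"

lemma positive_comb: "positive n (comb d n)"
  by (induction n) (auto intro: positive.intros)

lemma comb_closed [simp]: "comb d n \<in> carrier K"
  using positive_comb positive_closed by blast

text \<open>Behind the \<open>n\<close> squares that are cut, all numbers increase by \<open>n\<close>.\<close>

lemma past_comb: "n \<le> j \<Longrightarrow> z k j \<otimes> comb d n = comb d n \<otimes> z k (j + n)"
proof (induction n arbitrary: j)
  case (Suc n)
  then show ?case using Suc.IH[of "Suc j"] by (simp add: commute' m_assoc)
qed simp

lemma past_comb': "n \<le> j \<Longrightarrow> g \<in> carrier K
    \<Longrightarrow> z k j \<otimes> (comb d n \<otimes> g) = comb d n \<otimes> (z k (j + n) \<otimes> g)"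
  by (simp add: past_comb m_assoc[symmetric])

text \<open>Exchanging two squares that are both cut once amounts to exchanging two pairs of halves.\<close>

lemma swap_comb:
  assumes "Suc (Suc j) \<le> n"
  shows "\<exists>w. positive 0 w \<and> s j \<otimes> comb e n = comb e n \<otimes> w"
  using assms
proof (induction n rule: dec_induct)
  case base
  have past: "s j \<otimes> (x e (Suc j) \<otimes> (x e j \<otimes> g)) = x e (Suc j) \<otimes> (x e j \<otimes>
      (s (Suc j) \<otimes> (s (Suc (Suc j)) \<otimes> (s j \<otimes> (s (Suc j) \<otimes> g)))))"
    if [simp]: "g \<in> carrier K" for g
    using commute'[of j "Suc j" _ "Some e" e, symmetric] by (simp add: turn_back turn')
  have "s j \<otimes> comb e (Suc (Suc j))
      = comb e (Suc (Suc j)) \<otimes> (s (Suc j + j) \<otimes> (s (Suc (Suc j) + j) \<otimes> (s (j + j) \<otimes> s (Suc j + j))))"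
    by (simp add: past) (simp add: past_comb past_comb' m_assoc)
  then show ?case by (blast intro: positive_s positive.swap)
next
  case (step n)
  then obtain w where w: "positive 0 w" "s j \<otimes> comb e n = comb e n \<otimes> w" by blast
  then have "s j \<otimes> comb e (Suc n) = comb e (Suc n) \<otimes> w"
    using step.hyps by (simp add: far' m_assoc)
  with w show ?case by blast
qed

text \<open>If \<open>S\<^sub>j\<close> is cut in direction \<open>d\<close> and then everything is cut in direction \<open>e\<close>, the cuts in
  direction \<open>e\<close> can be made first: for \<open>d \<noteq> e\<close> the relation \<open>cross\<close> exchanges the two orders of
  cutting into quarters. The comb on the left-hand side is longer by one because \<open>S\<^sub>j\<close> contributes two rectangles.\<close>

lemma cut_comb:
  assumes "Suc j \<le> n"
  shows "\<exists>m w. positive m w \<and> x d j \<otimes> comb e (Suc n) = comb e n \<otimes> w"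
  using assms
proof (induction n rule: dec_induct)
  case base
  show ?case
  proof (cases "d = e")
    case True
    have "x d j \<otimes> comb e (Suc (Suc j)) = comb e (Suc j) \<otimes> (x e (Suc j + j) \<otimes> x e (j + j))"
      using True by (simp add: past_comb past_comb' m_assoc)
    then show ?thesis using positive.cut[OF positive_x] by blast
  next
    case False
    have "x d j \<otimes> comb e (Suc (Suc j))
        = comb e (Suc j) \<otimes> (x d (Suc j + j) \<otimes> (x d (j + j) \<otimes> s (Suc j + j)))"
      using cross'[of d e "comb e j" j] False by simp (simp add: past_comb past_comb' m_assoc)
    then show ?thesis using positive.cut[OF positive.cut[OF positive_s]] by blast
  qed
next
  case (step n)
  then obtain m w where w: "positive m w" "x d j \<otimes> comb e (Suc n) = comb e n \<otimes> w" by blast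
  have "x d j \<otimes> comb e (Suc (Suc n)) = x e n \<otimes> (x d j \<otimes> comb e (Suc n))"
    using step.hyps commute'[of j n "comb e (Suc n)" "Some e" d] by simp
  also have "\<dots> = comb e (Suc n) \<otimes> w" using w by (simp add: m_assoc)
  finally show ?case using w by blast
qed

text \<open>A long enough comb in direction \<open>e\<close> can be moved from the right end of a positive element to the
  left end, becoming shorter by the number of cuts passed.\<close>

lemma positive_comb_past:
  "positive k p \<Longrightarrow> \<exists>n0. \<forall>n\<ge>n0. \<exists>m w. positive m w \<and> p \<otimes> comb e (n + k) = comb e n \<otimes> w"
proof (induction rule: positive.induct)
  case one
  show ?case using positive.one by force
next
  case (swap k p j)
  then obtain n0 where n0: "\<And>n. n \<ge> n0 \<Longrightarrow> \<exists>m w. positive m w \<and> p \<otimes> comb e (n + k) = comb e n \<otimes> w"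
    by blast
  have "\<exists>m w. positive m w \<and> (s j \<otimes> p) \<otimes> comb e (n + k) = comb e n \<otimes> w"
    if large: "n \<ge> n0 + Suc (Suc j)" for n
  proof -
    obtain m w where w: "positive m w" "p \<otimes> comb e (n + k) = comb e n \<otimes> w"
      using n0[of n] large by auto
    obtain w' where w': "positive 0 w'" "s j \<otimes> comb e n = comb e n \<otimes> w'"
      using swap_comb[of j n e] large by auto
    have "(s j \<otimes> p) \<otimes> comb e (n + k) = (s j \<otimes> comb e n) \<otimes> w"
      using swap.hyps w by (simp add: m_assoc)
    also have "\<dots> = comb e n \<otimes> (w' \<otimes> w)" using w w' by (simp add: m_assoc)
    finally show ?thesis using positive_s_left[OF w'(1) w(1)] by blast
  qed
  then show ?case by blast
next
  case (cut k p d j)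
  then obtain n0 where n0: "\<And>n. n \<ge> n0 \<Longrightarrow> \<exists>m w. positive m w \<and> p \<otimes> comb e (n + k) = comb e n \<otimes> w"
    by blast
  have "\<exists>m w. positive m w \<and> (x d j \<otimes> p) \<otimes> comb e (n + Suc k) = comb e n \<otimes> w"
    if large: "n \<ge> n0 + Suc j" for n
  proof -
    obtain m w where w: "positive m w" "p \<otimes> comb e (Suc n + k) = comb e (Suc n) \<otimes> w"
      using n0[of "Suc n"] large by auto
    obtain m' w' where w': "positive m' w'" "x d j \<otimes> comb e (Suc n) = comb e n \<otimes> w'"
      using cut_comb[of j n d e] large by (auto simp del: comb.simps)
    have "(x d j \<otimes> p) \<otimes> comb e (n + Suc k) = (x d j \<otimes> comb e (Suc n)) \<otimes> w"
      using cut.hyps w by (simp add: m_assoc)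
    also have "\<dots> = comb e n \<otimes> (w' \<otimes> w)" using w w' by (simp only: m_assoc positive_closed comb_closed)
    finally show ?thesis using positive_mult[OF w'(1) w(1)] by blast
  qed
  then show ?case by blast
qed

lemma comb_cut_first:
  assumes "Suc i \<le> n"
  shows "\<exists>m w. positive m w \<and> comb e n = x e i \<otimes> w"
  using assms
proof (induction n rule: dec_induct)
  case base
  show ?case using positive_comb by auto
next
  case (step n)
  then obtain m w where w: "positive m w" "comb e n = x e i \<otimes> w" by blast
  then have "comb e (Suc n) = x e i \<otimes> (x e (Suc n) \<otimes> w)"
    using step.hyps by (simp add: commute')
  with w show ?case using positive.cut by blast
qed

text \<open>After a long comb on the right, the word can be started with a comb, and hence with any chosen cut.\<close>

lemma common_multiple:
  assumes "positive k p"
  obtains m q n w where "positive m q" "positive n w" "p \<otimes> q = x e i \<otimes> w"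
proof -
  from positive_comb_past[OF assms] obtain n0 where
    "\<And>n. n \<ge> n0 \<Longrightarrow> \<exists>m w. positive m w \<and> p \<otimes> comb e (n + k) = comb e n \<otimes> w" by blast
  then obtain m w where w: "positive m w"
    "p \<otimes> comb e (n0 + Suc i + k) = comb e (n0 + Suc i) \<otimes> w"
    by (metis le_add1)
  obtain m' w' where w': "positive m' w'" "comb e (n0 + Suc i) = x e i \<otimes> w'"
    using comb_cut_first[of i "n0 + Suc i" e] by auto
  have "p \<otimes> comb e (n0 + Suc i + k) = x e i \<otimes> (w' \<otimes> w)"
    unfolding w(2) w'(2) using w(1) w'(1) by (simp add: m_assoc)
  with positive_comb positive_mult[OF w'(1) w(1)] show thesis by (rule that)
qed

subsection \<open>Products of swaps\<close>

inductive swaps :: "nat \<Rightarrow> 'a \<Rightarrow> bool" for n where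
  one: "swaps n \<one>"
| swap: "swaps n w \<Longrightarrow> i < n \<Longrightarrow> swaps n (w \<otimes> s i)"

lemma swaps_closed [simp]: "swaps n w \<Longrightarrow> w \<in> carrier K"
  by (induction rule: swaps.induct) auto

lemma swaps_mono: "swaps n w \<Longrightarrow> n \<le> m \<Longrightarrow> swaps m w"
  by (induction rule: swaps.induct) (auto intro: swaps.intros)

lemma swaps_mult: "swaps n u \<Longrightarrow> swaps n w \<Longrightarrow> swaps n (w \<otimes> u)"
  by (induction rule: swaps.induct) (auto simp: m_assoc[symmetric] intro: swaps.intros)

lemma positive_0_swaps:
  assumes "positive 0 g"
  obtains n where "swaps n g"
proof -
  have "\<exists>n. swaps n g" if "positive k g" "k = 0" for k g
    using that
  proof (induction rule: positive.induct)
    case (swap k g i)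
    then obtain n where "swaps n g" by auto
    moreover have "swaps (Suc i) (s i)" using swaps.swap[OF swaps.one, of i "Suc i"] by simp
    ultimately have "swaps (max n (Suc i)) (s i \<otimes> g)"
      by (intro swaps_mult) (auto intro: swaps_mono)
    then show ?case by blast
  qed (auto intro: swaps.one)
  with assms that show thesis by blast
qed

lemma swaps_inverse: "swaps n w \<Longrightarrow> \<exists>w'. w' \<in> carrier K \<and> w \<otimes> w' = \<one>"
proof (induction rule: swaps.induct)
  case (swap w i)
  then obtain w' where "w' \<in> carrier K" "w \<otimes> w' = \<one>" by blast
  with swap.hyps show ?case by (intro exI[of _ "s i \<otimes> w'"]) (simp add: m_assoc square')
qed auto

text \<open>The cycle \<open>\<sigma>\<^sub>k\<^sub>+\<^sub>m\<^sub>-\<^sub>1 \<cdots> \<sigma>\<^sub>k\<close>, which takes \<open>k\<close> to \<open>k + m\<close> and lowers \<open>k + 1, ..., k + m\<close> by one.\<close>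

fun run :: "nat \<Rightarrow> nat \<Rightarrow> 'a" where
  "run k 0 = \<one>"
| "run k (Suc m) = s (k + m) \<otimes> run k m"

lemma run_swaps: "swaps (k + m) (run k m)"
proof (induction m)
  case (Suc m)
  have "swaps (k + Suc m) (s (k + m))"
    using swaps.swap[OF swaps.one, of "k + m" "k + Suc m"] by simp
  moreover have "swaps (k + Suc m) (run k m)" using Suc by (rule swaps_mono) simp
  ultimately show ?case by (auto dest: swaps_mult)
qed (auto intro: swaps.one)

lemma run_closed [simp]: "run k m \<in> carrier K"
  using run_swaps swaps_closed by blast

text \<open>The next four lemmas say how a run meets a single swap. Together they show that the set of
  products of a short word of swaps with a run is closed under multiplication by swaps on
  the right.\<close>

lemma run_extend: "run (Suc j) m \<otimes> s j = run j (Suc m)"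
  by (induction m) (simp_all add: m_assoc)

lemma run_below: "Suc j < k \<Longrightarrow> run k m \<otimes> s j = s j \<otimes> run k m"
  by (induction m) (simp_all add: m_assoc far')

lemma run_above: "k + m < j \<Longrightarrow> s j \<otimes> run k m = run k m \<otimes> s j"
proof (induction m)
  case (Suc m)
  then have "s j \<otimes> (s (k + m) \<otimes> run k m) = s (k + m) \<otimes> (s j \<otimes> run k m)"
    by (subst far') auto
  with Suc show ?case by (simp add: m_assoc)
qed simp

lemma run_inside: "k \<le> j \<Longrightarrow> Suc j < k + m \<Longrightarrow> run k m \<otimes> s (Suc j) = s j \<otimes> run k m"
proof (induction m)
  case (Suc m)
  show ?case
  proof (cases "Suc j < k + m")
    case True
    with Suc have "run k (Suc m) \<otimes> s (Suc j) = s (k + m) \<otimes> (s j \<otimes> run k m)"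
      by (simp add: m_assoc)
    also have "\<dots> = s j \<otimes> (s (k + m) \<otimes> run k m)" using True by (simp add: far')
    finally show ?thesis by simp
  next
    case False
    with Suc.prems have "m = Suc (j - k)" "j = k + (j - k)" by auto
    then obtain m' where m: "m = Suc m'" "j = k + m'" by blast
    \<comment> \<open>the swap meets the two top letters of the run: braid relation\<close>
    have "run k (Suc m) \<otimes> s (Suc j) = s (Suc j) \<otimes> (s j \<otimes> (run k m' \<otimes> s (Suc j)))"
      using m by (simp add: m_assoc)
    also have "\<dots> = s (Suc j) \<otimes> (s j \<otimes> (s (Suc j) \<otimes> run k m'))"
      using m run_above[of k m' "Suc j"] by simp
    also have "\<dots> = s j \<otimes> (s (Suc j) \<otimes> (s j \<otimes> run k m'))"
      by (simp add: braid')
    finally show ?thesis using m by simp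
  qed
qed simp

text \<open>The runs represent all right cosets of the symmetric group on \<open>{0..n}\<close> in the one on
  \<open>{0..n+1}\<close>; only the Coxeter relations are used to bring an arbitrary word into this form.\<close>

lemma swaps_coset:
  "swaps (Suc n) w \<Longrightarrow> \<exists>w' k m. swaps n w' \<and> k + m = Suc n \<and> w = w' \<otimes> run k m"
proof (induction rule: swaps.induct)
  case one
  have "\<one> = \<one> \<otimes> run (Suc n) 0" by simp
  then show ?case using swaps.one add_0_right by blast
next
  case (swap w j)
  then obtain w' k m where w': "swaps n w'" "k + m = Suc n" "w = w' \<otimes> run k m" by blast
  have closed [simp]: "w' \<in> carrier K" using w' by simp
  have w: "w \<otimes> s j = w' \<otimes> (run k m \<otimes> s j)" using w' by (simp add: m_assoc)
  have "Suc j < k \<or> Suc j = k \<or> j = k \<and> m > 0 \<or> (k < j \<and> j < k + m)"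
    using w'(2) swap.hyps(2) by linarith
  then consider "Suc j < k" | "Suc j = k" | "j = k" "m > 0"
    | i where "j = Suc i" "k \<le> i" "Suc i < k + m"
    by (metis Suc_le_eq less_Suc_eq_le less_imp_Suc_add)
  then show ?case
  proof cases
    case 1
    have "w \<otimes> s j = (w' \<otimes> s j) \<otimes> run k m" using 1 w by (simp add: run_below m_assoc)
    moreover have "swaps n (w' \<otimes> s j)" using w' 1 by (intro swaps.swap) auto
    ultimately show ?thesis using w'(2) by blast
  next
    case 2
    then have "w \<otimes> s j = w' \<otimes> run j (Suc m)" using w run_extend by auto
    then show ?thesis using w' 2 by (intro exI[of _ w'] exI[of _ j] exI[of _ "Suc m"]) auto
  next
    case 3
    then obtain m' where m: "m = Suc m'" by (cases m) auto
    have "w \<otimes> s j = w' \<otimes> run (Suc k) m'"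
      using w 3 m run_extend[of k m', symmetric] by (simp add: m_assoc square del: run.simps)
    then show ?thesis using w' m by (intro exI[of _ w'] exI[of _ "Suc k"] exI[of _ m']) auto
  next
    case 4
    have "w \<otimes> s j = (w' \<otimes> s i) \<otimes> run k m" using 4 w by (simp add: run_inside m_assoc)
    moreover have "swaps n (w' \<otimes> s i)" using w' 4 by (intro swaps.swap) auto
    ultimately show ?thesis using w'(2) by blast
  qed
qed

end

section \<open>Reduction to finitely many relations\<close>

text \<open>These are the given relations, grouped into families, together with the equation
  \<open>z\<^sub>i\<^sub>+\<^sub>1 v\<^sub>0 = v\<^sub>0 z\<^sub>i\<^sub>+\<^sub>2\<close> that defines the letters with index at least 2.\<close>

locale brin_presentation = group G for G (structure) +
  fixes z :: "bool option \<Rightarrow> nat \<Rightarrow> 'a"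
  assumes gen_closed [simp]: "z k i \<in> carrier G"
    and shift: "z k (Suc i) \<otimes> z (Some True) 0 = z (Some True) 0 \<otimes> z k (Suc (Suc i))"
    and commute_1: "j \<in> {2, 3} \<Longrightarrow> z k j \<otimes> z (Some d) 1 = z (Some d) 1 \<otimes> z k (Suc j)"
    and commute_0: "j \<in> {1, 2} \<Longrightarrow> z k j \<otimes> z (Some False) 0 = z (Some False) 0 \<otimes> z k (Suc j)"
    and far_0: "j \<in> {2, 3} \<Longrightarrow> z None 0 \<otimes> z k j = z k j \<otimes> z None 0"
    and far_1: "j \<in> {3, 4} \<Longrightarrow> z None 1 \<otimes> z k j = z k j \<otimes> z None 1"
    and turn_01: "i \<in> {0, 1} \<Longrightarrow>
      z None i \<otimes> z (Some d) i = z (Some d) (Suc i) \<otimes> z None i \<otimes> z None (Suc i)"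
    and square_01: "i \<in> {0, 1} \<Longrightarrow> z None i \<otimes> z None i = \<one>"
    and braid_01: "i \<in> {0, 1} \<Longrightarrow>
      z None i \<otimes> z None (Suc i) \<otimes> z None i = z None (Suc i) \<otimes> z None i \<otimes> z None (Suc i)"
    and cross_01: "i \<in> {0, 1} \<Longrightarrow>
      z (Some True) i \<otimes> z (Some False) (Suc i) \<otimes> z (Some False) i
      = z (Some False) i \<otimes> z (Some True) (Suc i) \<otimes> z (Some True) i \<otimes> z None (Suc i)"
begin

text \<open>Conjugation by \<open>v\<^sub>0\<close> is an automorphism that raises the positive indices by one. A relation between
  letters of positive index therefore implies all its shifts.\<close>

definition conj_v0 :: "'a \<Rightarrow> 'a" where
  "conj_v0 g = inv (z (Some True) 0) \<otimes> (g \<otimes> z (Some True) 0)"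

lemma conj_v0_mult:
  "g \<in> carrier G \<Longrightarrow> g' \<in> carrier G \<Longrightarrow> conj_v0 (g \<otimes> g') = conj_v0 g \<otimes> conj_v0 g'"
  unfolding conj_v0_def by (simp add: m_assoc) (simp add: m_assoc[symmetric])

lemma conj_v0_one: "conj_v0 \<one> = \<one>"
  by (simp add: conj_v0_def)

lemma conj_v0_z: "conj_v0 (z k (Suc i)) = z k (Suc (Suc i))"
  unfolding conj_v0_def shift by (simp add: m_assoc[symmetric])

lemmas conj_v0_simps = conj_v0_mult conj_v0_one conj_v0_z

text \<open>Commutation of \<open>y\<close> with \<open>g\<close> up to a shift is carried over to the next letter \<open>y' = u\<^sup>-\<^sup>1 y u\<close>: conjugating
  by \<open>u\<close> before passing \<open>g\<close> is conjugating by \<open>u'\<close> after passing it.\<close>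

lemma transport:
  assumes "y \<in> carrier G" "y' \<in> carrier G" "y'' \<in> carrier G" "u \<in> carrier G" "u' \<in> carrier G"
    "g \<in> carrier G"
    and "y \<otimes> u = u \<otimes> y'" "u \<otimes> g = g \<otimes> u'" "y \<otimes> g = g \<otimes> y'" "y' \<otimes> u' = u' \<otimes> y''"
  shows "y' \<otimes> g = g \<otimes> y''"
proof -
  have "u \<otimes> (y' \<otimes> g) = (y \<otimes> u) \<otimes> g" using assms(1-6,7) by (simp add: m_assoc)
  also have "\<dots> = (y \<otimes> g) \<otimes> u'" using assms(1-6,8) by (simp add: m_assoc)
  also have "\<dots> = g \<otimes> (y' \<otimes> u')" using assms(1-6,9) by (simp add: m_assoc)
  also have "\<dots> = (g \<otimes> u') \<otimes> y''" using assms(1-6,10) by (simp add: m_assoc)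
  also have "\<dots> = (u \<otimes> g) \<otimes> y''" using assms by simp
  also have "\<dots> = u \<otimes> (g \<otimes> y'')" using assms(1-6) by (simp add: m_assoc)
  finally show ?thesis using assms(1-6) by simp
qed

text \<open>Two starting values suffice: for \<open>j \<ge> 4\<close> the letter \<open>z\<^sub>j\<close> is the conjugate of \<open>z\<^sub>j\<^sub>-\<^sub>1\<close> by \<open>v\<^sub>2\<close>, and the
  relations between \<open>z\<^sub>j\<close> and \<open>v\<^sub>3\<close> that the transport needs are shifts of an earlier instance.\<close>

lemma commute_all_1:
  "2 \<le> j \<Longrightarrow> z k j \<otimes> z (Some d) 1 = z (Some d) 1 \<otimes> z k (Suc j)"
proof (induction j arbitrary: k d rule: less_induct)
  case (less j)
  show ?case
  proof (cases "j \<in> {2, 3}")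
    case False
    with less.prems obtain i where j: "j = Suc (Suc i)" "2 \<le> i"
      by (cases j; cases "j - 1") auto
    have v1: "z k i \<otimes> z (Some True) 1 = z (Some True) 1 \<otimes> z k (Suc i)"
      using less.IH[of i] j by simp
    obtain i' where i': "i = Suc i'" using j by (cases i) auto
    have v2: "z k (Suc i) \<otimes> z (Some True) 2 = z (Some True) 2 \<otimes> z k j"
      using arg_cong[OF v1, of conj_v0] j i' by (simp add: conj_v0_simps numeral_2_eq_2)
    have v3: "z k j \<otimes> z (Some True) 3 = z (Some True) 3 \<otimes> z k (Suc j)"
      using arg_cong[OF v2, of conj_v0] j by (simp add: conj_v0_simps numeral_2_eq_2 numeral_3_eq_3)
    show ?thesis
    proof (rule transport[OF _ _ _ _ _ _ v2 _ _ v3])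
      show "z (Some True) 2 \<otimes> z (Some d) 1 = z (Some d) 1 \<otimes> z (Some True) 3"
        using commute_1[of 2 "Some True" d] by simp
      show "z k (Suc i) \<otimes> z (Some d) 1 = z (Some d) 1 \<otimes> z k j"
        using less.IH[of "Suc i"] j by simp
    qed auto
  qed (use commute_1 in blast)
qed

lemma commute_Suc:
  "Suc i < j \<Longrightarrow> z k j \<otimes> z (Some d) (Suc i) = z (Some d) (Suc i) \<otimes> z k (Suc j)"
proof (induction i arbitrary: j)
  case 0
  then show ?case using commute_all_1[of j k d] by simp
next
  case (Suc i)
  then obtain j' where "j = Suc j'" "Suc i < j'" by (cases j) auto
  then obtain l where j: "j = Suc (Suc l)" "Suc i < Suc l" by (cases j') auto
  show ?case using arg_cong[OF Suc.IH[OF j(2)], of conj_v0] j(1) by (simp add: conj_v0_simps)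
qed

text \<open>The same induction with \<open>v\<^sub>1\<close> in the role of \<open>v\<^sub>2\<close>. For \<open>v\<^sub>0\<close> in place of \<open>h\<^sub>0\<close> the relation is the
  definition of the letters.\<close>

lemma commute_h0:
  "1 \<le> j \<Longrightarrow> z k j \<otimes> z (Some False) 0 = z (Some False) 0 \<otimes> z k (Suc j)"
proof (induction j rule: less_induct)
  case (less j)
  show ?case
  proof (cases "j \<in> {1, 2}")
    case False
    with less.prems obtain i where j: "j = Suc i" "2 \<le> i"
      by (cases j) auto
    show ?thesis
    proof (rule transport)
      show "z k i \<otimes> z (Some True) 1 = z (Some True) 1 \<otimes> z k j"
        using commute_all_1[of i] j by simp
      show "z (Some True) 1 \<otimes> z (Some False) 0 = z (Some False) 0 \<otimes> z (Some True) 2"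
        using commute_0[of 1 "Some True"] by (simp add: numeral_2_eq_2)
      show "z k i \<otimes> z (Some False) 0 = z (Some False) 0 \<otimes> z k j"
        using less.IH[of i] j by simp
      show "z k j \<otimes> z (Some True) 2 = z (Some True) 2 \<otimes> z k (Suc j)"
        using commute_Suc[of 1 j k True] j by (simp add: numeral_2_eq_2)
    qed auto
  qed (use commute_0 in blast)
qed

lemma commute_all:
  assumes "i < j"
  shows "z k j \<otimes> z (Some d) i = z (Some d) i \<otimes> z k (Suc j)"
proof (cases i)
  case 0
  from assms obtain j' where j: "j = Suc j'" by (cases j) auto
  show ?thesis using 0 assms commute_h0[of j k] shift[of k j'] j by (cases d) auto
next
  case (Suc i')
  then show ?thesis using assms commute_Suc[of i' j k d] by simp
qed

text \<open>A letter \<open>v\<^sub>l\<close> that commutes with \<open>\<sigma>\<^sub>i\<close> carries commutation with \<open>\<sigma>\<^sub>i\<close> from \<open>z\<^sub>j\<close> to its conjugate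
  \<open>z\<^sub>j\<^sub>+\<^sub>1\<close>.\<close>

lemma far_step:
  assumes "z None i \<otimes> z (Some True) l = z (Some True) l \<otimes> z None i"
    and "z None i \<otimes> z k j = z k j \<otimes> z None i" and "l < j"
  shows "z None i \<otimes> z k (Suc j) = z k (Suc j) \<otimes> z None i"
proof -
  let ?u = "z (Some True) l" and ?s = "z None i"
  have "?u \<otimes> (?s \<otimes> z k (Suc j)) = ?s \<otimes> (?u \<otimes> z k (Suc j))"
    using assms(1) by (simp flip: m_assoc)
  also have "\<dots> = (?s \<otimes> z k j) \<otimes> ?u" using commute_all[OF assms(3)] by (simp add: m_assoc)
  also have "\<dots> = z k j \<otimes> (?u \<otimes> ?s)" using assms(1,2) by (simp add: m_assoc)
  also have "\<dots> = ?u \<otimes> (z k (Suc j) \<otimes> ?s)" using commute_all[OF assms(3)] by (simp flip: m_assoc)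
  finally show ?thesis by simp
qed

lemma far_all:
  "Suc i < j \<Longrightarrow> z None i \<otimes> z k j = z k j \<otimes> z None i"
proof (induction i arbitrary: j)
  case 0
  then have "2 \<le> j" by simp
  then show ?case
  proof (induction j rule: dec_induct)
    case (step j)
    then show ?case
      using far_step[of 0 2 k j] far_0[of 2 "Some True"] far_0[of 3 k]
      by (cases "j = 2") (auto simp: numeral_3_eq_3 numeral_2_eq_2)
  qed (use far_0 in simp)
next
  case (Suc i)
  note IH = Suc.IH and prems = Suc.prems
  show ?case
  proof (cases i)
    case 0
    have "3 \<le> j" using prems 0 by simp
    then show ?thesis unfolding 0
    proof (induction j rule: dec_induct)
      case (step j)
      then show ?case
        using far_step[of 1 3 k j] far_1[of 3 "Some True"] far_1[of 4 k]
        by (cases "j = 3") auto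
    qed (use far_1[of 3 k] in simp)
  next
    case (Suc i')
    from prems Suc obtain j' where j: "j = Suc (Suc j')" "Suc i < Suc j'"
      by (cases j; cases "j - 1") auto
    show ?thesis using arg_cong[OF IH[OF j(2)], of conj_v0] j(1) Suc by (simp add: conj_v0_simps)
  qed
qed

lemma from_01:
  assumes "\<And>i. i \<in> {0, 1} \<Longrightarrow> Q i" and "\<And>i. Q (Suc i) \<Longrightarrow> Q (Suc (Suc i))"
  shows "Q (i :: nat)"
proof -
  have "Q (Suc n)" for n by (induction n) (use assms in auto)
  then show ?thesis using assms(1) by (cases i) auto
qed

sublocale numbering_monoid G z
proof
  show "z None i \<otimes> z (Some d) i = z (Some d) (Suc i) \<otimes> (z None i \<otimes> z None (Suc i))" for i d
    by (rule from_01[of _ i], use turn_01 in \<open>simp add: m_assoc\<close>)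
      (drule arg_cong[of _ _ conj_v0], simp add: conj_v0_simps)
  show "z None i \<otimes> z None i = \<one>" for i
    by (rule from_01[of _ i], use square_01 in simp)
      (drule arg_cong[of _ _ conj_v0], simp add: conj_v0_simps)
  show "z None i \<otimes> (z None (Suc i) \<otimes> z None i)
      = z None (Suc i) \<otimes> (z None i \<otimes> z None (Suc i))" for i
    by (rule from_01[of _ i], use braid_01 in \<open>simp add: m_assoc\<close>)
      (drule arg_cong[of _ _ conj_v0], simp add: conj_v0_simps)
  show "z (Some True) i \<otimes> (z (Some False) (Suc i) \<otimes> z (Some False) i)
      = z (Some False) i \<otimes> (z (Some True) (Suc i) \<otimes> (z (Some True) i \<otimes> z None (Suc i)))" for i
    by (rule from_01[of _ i], use cross_01 in \<open>simp add: m_assoc\<close>)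
      (drule arg_cong[of _ _ conj_v0], simp add: conj_v0_simps)
qed (simp_all add: commute_all far_all)

text \<open>From \<open>p r = x w\<close> follows \<open>x\<^sup>-\<^sup>1 p = w r\<^sup>-\<^sup>1\<close>: a common multiple moves the inverse of a cut to the right.\<close>

lemma fraction_inv_cut:
  assumes "positive n p" "positive m q"
  shows "\<exists>n' p' m' q'. positive n' p' \<and> positive m' q'
    \<and> inv (x e i) \<otimes> (p \<otimes> inv q) = p' \<otimes> inv q'"
proof -
  obtain k r l w where r: "positive k r" "positive l w" "p \<otimes> r = x e i \<otimes> w"
    using common_multiple[OF assms(1)] by metis
  have [simp]: "p \<in> carrier G" "q \<in> carrier G" "r \<in> carrier G" "w \<in> carrier G"
    using assms r by auto
  have "p = (p \<otimes> r) \<otimes> inv r" by (simp add: m_assoc)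
  then have "p = x e i \<otimes> (w \<otimes> inv r)" using r by (simp add: m_assoc)
  then have "inv (x e i) \<otimes> (p \<otimes> inv q) = inv (x e i) \<otimes> (x e i \<otimes> (w \<otimes> (inv r \<otimes> inv q)))"
    by (simp add: m_assoc)
  also have "\<dots> = w \<otimes> inv (q \<otimes> r)" by (simp add: m_assoc[symmetric] inv_mult_group)
  finally show ?thesis using r positive_mult[OF assms(2) r(1)] by blast
qed

lemma fraction_inv_gen:
  assumes "positive n p" "positive m q"
  shows "\<exists>n' p' m' q'. positive n' p' \<and> positive m' q'
    \<and> inv (z k i) \<otimes> (p \<otimes> inv q) = p' \<otimes> inv q'"
proof (cases k)
  case None
  have "inv (s i) = s i" by (rule inv_equality) (simp_all add: square)
  then have "inv (z k i) \<otimes> (p \<otimes> inv q) = (s i \<otimes> p) \<otimes> inv q"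
    using assms None by (simp add: m_assoc)
  then show ?thesis using assms positive.swap by blast
next
  case (Some e)
  then show ?thesis using fraction_inv_cut[OF assms] by simp
qed

end

section \<open>Addresses of rectangles\<close>

text \<open>An address names a rectangle by its square and, for each direction (\<^const>\<open>True\<close> for the first
  coordinate), the list of thirds chosen on the way to it, outermost first; \<^const>\<open>True\<close> is the right or
  top third. Since directions are treated as data, facts about vertical and horizontal cuts need to be
  proved only once.\<close>

type_synonym address = "nat \<times> (bool \<Rightarrow> bool list)"

definition whole :: "nat \<Rightarrow> address" where
  "whole i = (i, \<lambda>_. [])"

definition half :: "bool \<Rightarrow> bool \<Rightarrow> nat \<Rightarrow> address" where
  "half d b i = (i, \<lambda>e. if e = d then [b] else [])"

text \<open>The rectangle whose position in the rectangle \<open>r\<close> is that of \<open>t\<close> in its square.\<close>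

definition inside :: "address \<Rightarrow> address \<Rightarrow> address" where
  "inside r t = (fst r, \<lambda>d. snd r d @ snd t d)"

text \<open>The encoding of the composition of the homeomorphisms belonging to \<open>A\<close> and \<open>B\<close>, with \<open>B\<close> applied
  first.\<close>

definition after :: "(nat \<Rightarrow> address) \<Rightarrow> (nat \<Rightarrow> address) \<Rightarrow> nat \<Rightarrow> address" (infixl "\<Zsemi>" 70) where
  "after A B = (\<lambda>n. inside (A (fst (B n))) (B n))"

definition cut_numbering :: "bool \<Rightarrow> nat \<Rightarrow> nat \<Rightarrow> address" where
  "cut_numbering d i n =
    (if n < i then whole n else if n = i then half d False i
     else if n = Suc i then half d True i else whole (n - 1))"

definition perm_numbering :: "(nat \<Rightarrow> nat) \<Rightarrow> nat \<Rightarrow> address" where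
  "perm_numbering f n = whole (f n)"

definition swap_numbering :: "nat \<Rightarrow> nat \<Rightarrow> address" where
  "swap_numbering i = perm_numbering (Transposition.transpose i (Suc i))"

fun numbering_gen :: "bool option \<Rightarrow> nat \<Rightarrow> nat \<Rightarrow> address" where
  "numbering_gen (Some d) i = cut_numbering d i"
| "numbering_gen None i = swap_numbering i"

definition numberings :: "(nat \<Rightarrow> address) monoid" where
  "numberings = \<lparr>carrier = UNIV, monoid.mult = (\<Zsemi>), one = whole\<rparr>"

lemma numberings_simps [simp]:
  "carrier numberings = UNIV" "A \<otimes>\<^bsub>numberings\<^esub> B = A \<Zsemi> B" "\<one>\<^bsub>numberings\<^esub> = whole"
  by (simp_all add: numberings_def)

lemma monoid_numberings: "monoid numberings"
  by (rule monoidI) (auto simp: after_def inside_def whole_def fun_eq_iff)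

lemma fst_address [simp]: "fst (whole i) = i" "fst (half d b i) = i"
  by (simp_all add: whole_def half_def)

lemma inside_address [simp]:
  "inside r (whole j) = r"
  "inside (whole i) t = (i, snd t)"
  "fst (inside r t) = fst r"
  "snd (inside r t) d = snd r d @ snd t d"
  by (simp_all add: inside_def whole_def)

lemma snd_address [simp]:
  "snd (whole i) d = []"
  "snd (half d b i) e = (if e = d then [b] else [])"
  "(i, snd (whole j)) = whole i"
  "(i, snd (half d b j)) = half d b i"
  by (simp_all add: whole_def half_def)

lemma inside_halves:
  "inside (half False b i) (half True c j) = (i, \<lambda>d. if d then [c] else [b])"
  "inside (half True c i) (half False b j) = (i, \<lambda>d. if d then [c] else [b])"
  by (auto simp: inside_def half_def fun_eq_iff)

lemma cut_numbering_simps [simp]: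
  "n < i \<Longrightarrow> cut_numbering d i n = whole n"
  "cut_numbering d i i = half d False i"
  "cut_numbering d i (Suc i) = half d True i"
  "i < n \<Longrightarrow> cut_numbering d i (Suc n) = whole n"
  "Suc i < n \<Longrightarrow> cut_numbering d i n = whole (n - 1)"
  by (simp_all add: cut_numbering_def)

lemma swap_numbering_simps [simp]:
  "swap_numbering i i = whole (Suc i)"
  "swap_numbering i (Suc i) = whole i"
  "n < i \<Longrightarrow> swap_numbering i n = whole n"
  "Suc i < n \<Longrightarrow> swap_numbering i n = whole n"
  by (simp_all add: swap_numbering_def perm_numbering_def transpose_def)

lemma after_apply: "(A \<Zsemi> B) n = inside (A (fst (B n))) (B n)"
  by (simp add: after_def)

lemma position_cases:
  obtains (below) "n < i" | (here) "n = i" | (succ) "n = Suc i" | (above) m where "n = Suc m" "i < m"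
  by (metis less_antisym linorder_neqE_nat not_less_eq less_imp_Suc_add Suc_lessI)

text \<open>All relations hold for numberings. Each is an equality of functions on the natural numbers, and
  only the position of the argument relative to the indices matters.\<close>

interpretation N: numbering_monoid numberings numbering_gen
proof (intro numbering_monoid.intro monoid_numberings, unfold_locales)
  fix i j :: nat and k d
  show "numbering_gen k j \<otimes>\<^bsub>numberings\<^esub> numbering_gen (Some d) i
      = numbering_gen (Some d) i \<otimes>\<^bsub>numberings\<^esub> numbering_gen k (Suc j)" if less: "i < j"
  proof
    fix n
    show "(numbering_gen k j \<otimes>\<^bsub>numberings\<^esub> numbering_gen (Some d) i) n
        = (numbering_gen (Some d) i \<otimes>\<^bsub>numberings\<^esub> numbering_gen k (Suc j)) n"
    proof (cases n i rule: position_cases)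
      case (above m)
      then show ?thesis using less
        by (cases m j rule: position_cases; cases k) (simp_all add: after_apply)
    qed (use less in \<open>cases k; simp add: after_apply\<close>)+
  qed
  show "numbering_gen None i \<otimes>\<^bsub>numberings\<^esub> numbering_gen k j
      = numbering_gen k j \<otimes>\<^bsub>numberings\<^esub> numbering_gen None i" if less: "Suc i < j"
  proof
    fix n
    show "(numbering_gen None i \<otimes>\<^bsub>numberings\<^esub> numbering_gen k j) n
        = (numbering_gen k j \<otimes>\<^bsub>numberings\<^esub> numbering_gen None i) n"
    proof (cases n j rule: position_cases)
      case below
      then show ?thesis using less
        by (cases n i rule: position_cases; cases k) (simp_all add: after_apply)
    qed (use less in \<open>cases k; simp add: after_apply\<close>)+
  qed
  show "numbering_gen None i \<otimes>\<^bsub>numberings\<^esub> numbering_gen (Some d) i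
      = numbering_gen (Some d) (Suc i) \<otimes>\<^bsub>numberings\<^esub>
        (numbering_gen None i \<otimes>\<^bsub>numberings\<^esub> numbering_gen None (Suc i))" (is "?l = ?r")
  proof
    fix n
    show "?l n = ?r n"
    proof (cases n i rule: position_cases)
      case (above m)
      then show ?thesis by (cases m "Suc i" rule: position_cases) (simp_all add: after_apply)
    qed (simp_all add: after_apply)
  qed
  show "numbering_gen None i \<otimes>\<^bsub>numberings\<^esub> numbering_gen None i = \<one>\<^bsub>numberings\<^esub>" (is "?l = ?r")
  proof
    show "?l n = ?r n" for n
      by (cases n i rule: position_cases) (simp_all add: after_apply)
  qed
  show "numbering_gen None i \<otimes>\<^bsub>numberings\<^esub> (numbering_gen None (Suc i) \<otimes>\<^bsub>numberings\<^esub> numbering_gen None i)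
      = numbering_gen None (Suc i) \<otimes>\<^bsub>numberings\<^esub>
        (numbering_gen None i \<otimes>\<^bsub>numberings\<^esub> numbering_gen None (Suc i))" (is "?l = ?r")
  proof
    fix n
    show "?l n = ?r n"
    proof (cases n i rule: position_cases)
      case (above m)
      then show ?thesis by (cases m "Suc i" rule: position_cases) (simp_all add: after_apply)
    qed (simp_all add: after_apply)
  qed
  show "numbering_gen (Some True) i \<otimes>\<^bsub>numberings\<^esub>
      (numbering_gen (Some False) (Suc i) \<otimes>\<^bsub>numberings\<^esub> numbering_gen (Some False) i)
      = numbering_gen (Some False) i \<otimes>\<^bsub>numberings\<^esub> (numbering_gen (Some True) (Suc i)
        \<otimes>\<^bsub>numberings\<^esub> (numbering_gen (Some True) i \<otimes>\<^bsub>numberings\<^esub> numbering_gen None (Suc i)))"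
    (is "?l = ?r")
  proof
    fix n
    show "?l n = ?r n"
    proof (cases n i rule: position_cases)
      case (above m)
      then show ?thesis
        by (cases m "Suc i" rule: position_cases)
          (simp_all add: after_apply inside_halves)
    qed (simp_all add: after_apply inside_halves)
  qed
qed simp

text \<open>Numberings need not be invertible, but a cut merely splits \<open>S\<^sub>i\<close> into disjoint halves and so can be
  cancelled on the left.\<close>

lemma cut_numbering_cancel:
  assumes "cut_numbering d i \<Zsemi> A = cut_numbering d i \<Zsemi> B"
  shows "A = B"
proof
  fix n
  have "inside (cut_numbering d i (fst (A n))) (A n) = inside (cut_numbering d i (fst (B n))) (B n)"
    using fun_cong[OF assms, of n] by (simp add: after_def)
  moreover have "r = t" if eq: "inside (cut_numbering d i (fst r)) r = inside (cut_numbering d i (fst t)) t"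
    for r t :: address
  proof -
    have "fst (cut_numbering d i (fst r)) = fst (cut_numbering d i (fst t))"
      using arg_cong[OF eq, of fst] by simp
    moreover have "snd (cut_numbering d i (fst r)) e @ snd r e = snd (cut_numbering d i (fst t)) e @ snd t e" for e
      using arg_cong[OF eq, of "\<lambda>u. snd u e"] by simp
    ultimately have "fst r = fst t \<and> snd r e = snd t e" for e
      by (cases "fst r" i rule: position_cases; cases "fst t" i rule: position_cases)
        (force split: if_splits)+
    then show ?thesis by (auto simp: prod_eq_iff)
  qed
  ultimately show "A n = B n" by blast
qed

section \<open>Equal numberings come from equal positive elements\<close>

text \<open>A monoid with the relations and a homomorphism to numberings. Only the relations are known about
  its elements; the conclusion will be that \<open>rep\<close> is injective on positive ones.\<close>

locale numbering_rep = numbering_monoid +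
  fixes rep :: "'a \<Rightarrow> nat \<Rightarrow> address"
  assumes rep_one [simp]: "rep \<one> = whole"
    and rep_mult [simp]: "g \<in> carrier K \<Longrightarrow> g' \<in> carrier K \<Longrightarrow> rep (g \<otimes> g') = rep g \<Zsemi> rep g'"
    and rep_gen [simp]: "rep (z k i) = numbering_gen k i"
begin

text \<open>The square \<open>S\<^sub>i\<close> is cut through in direction \<open>d\<close>: no rectangle of the pattern has full extent in
  this direction.\<close>

definition divided :: "bool \<Rightarrow> nat \<Rightarrow> 'a \<Rightarrow> bool" where
  "divided d i g \<longleftrightarrow> (\<forall>n. fst (rep g n) = i \<longrightarrow> snd (rep g n) d \<noteq> [])"

lemma divided_cut: "g \<in> carrier K \<Longrightarrow> divided d i (x d i \<otimes> g)"
  unfolding divided_def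
proof (intro allI impI)
  fix n assume g: "g \<in> carrier K" and n: "fst (rep (x d i \<otimes> g) n) = i"
  then show "snd (rep (x d i \<otimes> g) n) d \<noteq> []"
    by (cases "fst (rep g n)" i rule: position_cases) (simp_all add: after_apply)
qed

lemma divided_left:
  assumes "divided d i (a \<otimes> g)" "a \<in> carrier K" "g \<in> carrier K"
    and "fst (rep a j) = i" "snd (rep a j) d = []"
  shows "divided d j g"
  using assms unfolding divided_def by (auto simp: after_apply)

text \<open>The key step. The first letter of a word for \<open>g\<close> either is the wanted cut, or is a letter after
  which some square (or, for a cut of \<open>S\<^sub>i\<close> in the other direction, two squares) is still divided in
  direction \<open>d\<close>. Then the shorter word starts with a cut in direction \<open>d\<close>, and a relation brings it
  to the front. In the case of two squares, the second cut is extracted from a word with fewer cuts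
  that need not be shorter, which is why the outer induction is on the number of cuts.\<close>

lemma divided_cut_first:
  assumes "positive n g" "divided d i g"
  shows "\<exists>m g'. n = Suc m \<and> positive m g' \<and> g = x d i \<otimes> g'"
  using assms
proof (induction n arbitrary: g i rule: less_induct)
  case (less n)
  from less.prems(1) less.IH less.prems(2) show ?case
  proof (induction arbitrary: i rule: positive.induct)
    case one
    then have "snd (rep \<one> i) d \<noteq> []" unfolding divided_def by (simp add: whole_def)
    then show ?case by (simp add: whole_def)
  next
    case (swap n g j)
    let ?i = "Transposition.transpose j (Suc j) i"
    have "divided d ?i g"
      using swap.prems(2) swap.hyps
      by (intro divided_left[of d i "s j" g]) (auto simp: swap_numbering_def perm_numbering_def)
    then obtain m g' where g: "n = Suc m" "positive m g'" "g = x d ?i \<otimes> g'"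
      using swap.IH swap.prems(1) by blast
    from swap_past_cut[of j d i] obtain w where w: "positive 0 w" "s j \<otimes> x d ?i = x d i \<otimes> w"
      by blast
    have "s j \<otimes> g = (s j \<otimes> x d ?i) \<otimes> g'" using g by (simp add: m_assoc)
    also have "\<dots> = x d i \<otimes> (w \<otimes> g')" using g w by (simp add: m_assoc)
    finally show ?case using g positive_s_left[OF w(1) g(2)] by blast
  next
    case (cut n g e j)
    have IH: "\<exists>m g'. n = Suc m \<and> positive m g' \<and> g = x d i' \<otimes> g'" if "divided d i' g" for i'
      using cut.IH[OF _ that] cut.prems(1) by (meson less_SucI)
    have [simp]: "g \<in> carrier K" using cut.hyps by simp
    consider "e = d" "i = j" | "e \<noteq> d" "i = j" | "i < j" | "j < i" by linarith
    then show ?case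
    proof cases
      case 1
      then show ?thesis using cut.hyps by blast
    next
      case 2
      have "divided d (Suc i) g"
        using cut.prems(2) 2 by (intro divided_left[of d i "x e j" g]) auto
      then obtain m g1 where g1: "n = Suc m" "positive m g1" "g = x d (Suc i) \<otimes> g1"
        using IH by blast
      have [simp]: "g1 \<in> carrier K" using g1 by simp
      have "divided d i g"
        using cut.prems(2) 2 by (intro divided_left[of d i "x e j" g]) auto
      then have "divided d i g1"
        using g1(3) by (intro divided_left[of d i "x d (Suc i)" g1]) auto
      then obtain l g2 where g2: "m = Suc l" "positive l g2" "g1 = x d i \<otimes> g2"
        using cut.prems(1)[of m g1 i] g1 by auto
      \<comment> \<open>both halves are divided, so the cross relation applies\<close>
      have "x e j \<otimes> g = x e i \<otimes> (x d (Suc i) \<otimes> (x d i \<otimes> g2))" using g1 g2 2 by simp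
      also have "\<dots> = x d i \<otimes> (x e (Suc i) \<otimes> (x e i \<otimes> (s (Suc i) \<otimes> g2)))"
        using cross'[of e d g2 i] g2 2(1) by simp
      finally have "x e j \<otimes> g = x d i \<otimes> (x e (Suc i) \<otimes> (x e i \<otimes> (s (Suc i) \<otimes> g2)))" .
      moreover have "positive n (x e (Suc i) \<otimes> (x e i \<otimes> (s (Suc i) \<otimes> g2)))"
        using g1(1) g2(1,2) by (auto intro: positive.intros)
      ultimately show ?thesis by blast
    next
      case 3
      have "divided d i g"
        using cut.prems(2) 3 by (intro divided_left[of d i "x e j" g]) auto
      then obtain m g' where g: "n = Suc m" "positive m g'" "g = x d i \<otimes> g'"
        using IH by blast
      then have "x e j \<otimes> g = x d i \<otimes> (x e (Suc j) \<otimes> g')" using 3 by (simp add: commute')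
      then show ?thesis using g positive.cut[OF g(2)] by blast
    next
      case 4
      have "divided d (Suc i) g"
        using cut.prems(2) 4 by (intro divided_left[of d i "x e j" g]) auto
      then obtain m g' where g: "n = Suc m" "positive m g'" "g = x d (Suc i) \<otimes> g'"
        using IH by blast
      then have "x e j \<otimes> g = x d i \<otimes> (x e j \<otimes> g')" using 4 by (simp add: commute')
      then show ?thesis using g positive.cut[OF g(2)] by blast
    qed
  qed
qed

lemma rep_swaps:
  assumes "swaps n w"
  shows "\<exists>f. rep w = perm_numbering f \<and> (\<forall>i\<le>n. f i \<le> n) \<and> (\<forall>i>n. f i = i)"
  using assms
proof (induction rule: swaps.induct)
  case one
  have "rep \<one> = perm_numbering id" by (simp add: perm_numbering_def whole_def fun_eq_iff)
  then show ?case by auto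
next
  case (swap w i)
  then obtain f where f: "rep w = perm_numbering f" "\<forall>i\<le>n. f i \<le> n" "\<forall>i>n. f i = i" by blast
  have "rep (w \<otimes> s i) = perm_numbering (f \<circ> Transposition.transpose i (Suc i))"
    using swap.hyps f(1) by (simp add: fun_eq_iff after_apply swap_numbering_def perm_numbering_def)
  moreover have "\<forall>k\<le>n. (f \<circ> Transposition.transpose i (Suc i)) k \<le> n"
    "\<forall>k>n. (f \<circ> Transposition.transpose i (Suc i)) k = k"
    using f swap.hyps(2) by (auto simp: transpose_def)
  ultimately show ?case by blast
qed

lemma rep_run:
  "rep (run k m) = perm_numbering (\<lambda>n. if n = k then k + m else if k < n \<and> n \<le> k + m then n - 1 else n)"
proof (induction m)
  case (Suc m)
  then show ?case
    by (auto simp: fun_eq_iff after_apply perm_numbering_def swap_numbering_def transpose_def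
      le_Suc_eq)
qed (auto simp: fun_eq_iff perm_numbering_def)

text \<open>The run in the coset decomposition is determined by the number that is sent to \<open>n + 1\<close>; cancelling
  it leaves permutations of fewer numbers.\<close>

lemma swaps_unique:
  "swaps n g \<Longrightarrow> swaps n g' \<Longrightarrow> rep g = rep g' \<Longrightarrow> g = g'"
proof (induction n arbitrary: g g')
  case 0
  have "h = \<one>" if "swaps 0 h" for h
    using that by (cases rule: swaps.cases) auto
  with 0 show ?case by blast
next
  case (Suc n)
  have last: "\<exists>w k. swaps n w \<and> k \<le> Suc n \<and> h = w \<otimes> run k (Suc n - k)
      \<and> (\<forall>i. fst (rep h i) = Suc n \<longleftrightarrow> i = k)" if "swaps (Suc n) h" for h
  proof -
    from swaps_coset[OF that] obtain w k m
      where w: "swaps n w" "k + m = Suc n" "h = w \<otimes> run k m" by blast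
    from rep_swaps[OF w(1)] obtain f where f: "rep w = perm_numbering f"
      "\<forall>i\<le>n. f i \<le> n" "\<forall>i>n. f i = i" by blast
    have rep_h: "rep h = perm_numbering (\<lambda>i. f (if i = k then k + m else if k < i \<and> i \<le> k + m then i - 1 else i))"
      using w f(1) by (simp add: rep_run fun_eq_iff after_apply perm_numbering_def)
    have "fst (rep h i) = Suc n \<longleftrightarrow> i = k" for i
    proof -
      let ?j = "if i = k then k + m else if k < i \<and> i \<le> k + m then i - 1 else i"
      have "f j = Suc n \<longleftrightarrow> j = Suc n" for j
      proof (cases "j \<le> n")
        case True
        then have "f j \<le> n" using f(2) by blast
        with True show ?thesis by simp
      qed (use f(3) in auto)
      then have "f ?j = Suc n \<longleftrightarrow> ?j = Suc n" .
      moreover have "?j = Suc n \<longleftrightarrow> i = k" using w(2) by auto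
      ultimately show ?thesis using rep_h by (simp add: perm_numbering_def)
    qed
    moreover have "m = Suc n - k" "k \<le> Suc n" using w(2) by auto
    ultimately show ?thesis using w(1,3) by blast
  qed
  obtain w k where w: "swaps n w" "k \<le> Suc n" "g = w \<otimes> run k (Suc n - k)"
    "\<forall>i. fst (rep g i) = Suc n \<longleftrightarrow> i = k" using last[OF Suc.prems(1)] by blast
  obtain w' k' where w': "swaps n w'" "k' \<le> Suc n" "g' = w' \<otimes> run k' (Suc n - k')"
    "\<forall>i. fst (rep g' i) = Suc n \<longleftrightarrow> i = k'" using last[OF Suc.prems(2)] by blast
  have k: "k' = k" using w(4) w'(4) Suc.prems(3) by metis
  let ?r = "run k (Suc n - k)"
  obtain r where r: "r \<in> carrier K" "?r \<otimes> r = \<one>" using swaps_inverse[OF run_swaps] by blast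
  have undo: "rep u = rep (u \<otimes> ?r) \<Zsemi> rep r" if "u \<in> carrier K" for u
  proof -
    have "u = (u \<otimes> ?r) \<otimes> r" using that r by (simp add: m_assoc)
    then have "rep u = rep ((u \<otimes> ?r) \<otimes> r)" by simp
    also have "\<dots> = rep (u \<otimes> ?r) \<Zsemi> rep r" using that r by (subst rep_mult) auto
    finally show ?thesis .
  qed
  have "rep w = rep w'"
    using undo[of w] undo[of w'] w w' k Suc.prems(3) by simp
  then have "w = w'" using Suc.IH w(1) w'(1) by blast
  then show ?case using w w' k by simp
qed

text \<open>If \<open>g\<close> starts with a cut, then \<open>g'\<close> has the same pattern and so starts with this cut as well;
  cancelling the cut in the numbering leaves two elements with fewer cuts and the same numbering. If neither contains a cut, the coset
  normal form decides.\<close>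

theorem positive_unique:
  "positive n g \<Longrightarrow> positive m g' \<Longrightarrow> rep g = rep g' \<Longrightarrow> g = g'"
proof (induction n arbitrary: g m g')
  case 0
  have "m = 0"
  proof (rule ccontr)
    assume "m \<noteq> 0"
    then obtain l where "positive (Suc l) g'" using 0 by (cases m) auto
    then obtain d i h where "positive l h" "g' = x d i \<otimes> h" by (rule cut_first)
    then have "divided d i g'" using divided_cut by simp
    then have "divided d i g" using 0 by (simp add: divided_def)
    then show False using divided_cut_first[OF 0(1)] by blast
  qed
  obtain a b where "swaps a g" "swaps b g'" using 0 \<open>m = 0\<close> positive_0_swaps by metis
  then have "swaps (max a b) g" "swaps (max a b) g'" by (auto intro: swaps_mono)
  then show ?case using swaps_unique 0 by blast
next
  case (Suc n)
  from Suc.prems(1) obtain d i h where h: "positive n h" "g = x d i \<otimes> h" by (rule cut_first)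
  have "divided d i g" using divided_cut[of h d i] h by simp
  then have "divided d i g'" using Suc.prems(3) by (simp add: divided_def)
  from divided_cut_first[OF Suc.prems(2) this]
  obtain l h' where h': "positive l h'" "g' = x d i \<otimes> h'" by blast
  have "cut_numbering d i \<Zsemi> rep h = cut_numbering d i \<Zsemi> rep h'"
    using Suc.prems(3) h h' by simp
  then have "rep h = rep h'" by (rule cut_numbering_cancel)
  then show ?case using Suc.IH h h' by blast
qed

end

text \<open>A monoid with the relations need not come with a homomorphism to numberings that is known in
  advance. Pairing each letter with its numbering provides one: the elements of the product record an
  element and a numbering that are obtained from the same word.\<close>

lemma (in numbering_monoid) pair_rep:
  "numbering_rep (K \<times>\<times> numberings) (\<lambda>k i. (z k i, numbering_gen k i)) snd"
proof -
  interpret P: monoid "K \<times>\<times> numberings"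
    using DirProd_monoid[OF monoid_axioms monoid_numberings] .
  show ?thesis
  proof unfold_locales
    show "i < j \<Longrightarrow>
       (z k j, numbering_gen k j) \<otimes>\<^bsub>K \<times>\<times> numberings\<^esub> (z (Some d) i, numbering_gen (Some d) i) =
       (z (Some d) i, numbering_gen (Some d) i) \<otimes>\<^bsub>K \<times>\<times> numberings\<^esub> (z k (Suc j), numbering_gen k (Suc j))"
      for i j k d using commute N.commute by (simp only: mult_DirProd)
    show "Suc i < j \<Longrightarrow>
       (z None i, numbering_gen None i) \<otimes>\<^bsub>K \<times>\<times> numberings\<^esub> (z k j, numbering_gen k j) =
       (z k j, numbering_gen k j) \<otimes>\<^bsub>K \<times>\<times> numberings\<^esub> (z None i, numbering_gen None i)"
      for i j k using far N.far by (simp only: mult_DirProd)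
  qed (simp_all only: mult_DirProd one_DirProd turn square braid cross N.turn N.square N.braid N.cross carrier_DirProd
    z_closed N.z_closed SigmaI, auto simp: DirProd_def)
qed

section \<open>The Cantor set\<close>

lemma cantor_approx_bounds: "cantor_approx n \<subseteq> {0..1}"
  by (induction n) fastforce+

lemma cantor_approx_Suc_iff:
  "c \<in> cantor_approx (Suc n)
    \<longleftrightarrow> c \<le> 1 / 3 \<and> 3 * c \<in> cantor_approx n \<or> 2 / 3 \<le> c \<and> 3 * c - 2 \<in> cantor_approx n"
proof
  assume "c \<in> cantor_approx (Suc n)"
  then show "c \<le> 1 / 3 \<and> 3 * c \<in> cantor_approx n \<or> 2 / 3 \<le> c \<and> 3 * c - 2 \<in> cantor_approx n"
    using cantor_approx_bounds[of n] by fastforce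
next
  assume "c \<le> 1 / 3 \<and> 3 * c \<in> cantor_approx n \<or> 2 / 3 \<le> c \<and> 3 * c - 2 \<in> cantor_approx n"
  moreover have "c = (3 * c) / 3" "c = 2 / 3 + (3 * c - 2) / 3"
    by (simp_all add: field_simps)
  ultimately show "c \<in> cantor_approx (Suc n)" unfolding cantor_approx.simps by blast
qed

lemma Cantor_bounds: "c \<in> Cantor \<Longrightarrow> 0 \<le> c \<and> c \<le> 1"
  unfolding Cantor_def using cantor_approx_bounds by fastforce

lemma Cantor_iff:
  "c \<in> Cantor \<longleftrightarrow> c \<le> 1 / 3 \<and> 3 * c \<in> Cantor \<or> 2 / 3 \<le> c \<and> 3 * c - 2 \<in> Cantor"
proof -
  have "c \<in> Cantor \<longleftrightarrow> (\<forall>n. c \<in> cantor_approx (Suc n))"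
  proof -
    have "c \<in> cantor_approx 0" if "c \<in> cantor_approx (Suc 0)"
      using that cantor_approx_bounds[of "Suc 0"] by (metis cantor_approx.simps(1) subsetD)
    then show ?thesis unfolding Cantor_def by (metis INT_iff UNIV_I not0_implies_Suc)
  qed
  also have "\<dots> \<longleftrightarrow> c \<le> 1 / 3 \<and> 3 * c \<in> Cantor \<or> 2 / 3 \<le> c \<and> 3 * c - 2 \<in> Cantor"
    unfolding cantor_approx_Suc_iff Cantor_def by (cases "c \<le> 1 / 3") auto
  finally show ?thesis .
qed

text \<open>The position of \<open>c\<close> after rescaling the unit interval to the triadic interval selected by
  the list.\<close>

fun shrink :: "bool list \<Rightarrow> real \<Rightarrow> real" where
  "shrink [] c = c"
| "shrink (b # u) c = (if b then 2 / 3 else 0) + shrink u c / 3"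

lemma shrink_append: "shrink (u @ w) c = shrink u (shrink w c)"
  by (induction u) auto

lemma shrink_affine: "shrink u c = shrink u 0 + c / 3 ^ length u"
  by (induction u) (auto simp: field_simps)

lemma shrink_eq_iff [simp]: "shrink u c = shrink u c' \<longleftrightarrow> c = c'"
  using shrink_affine[of u c] shrink_affine[of u c'] by simp

lemma shrink_le_iff [simp]: "shrink u c \<le> shrink u c' \<longleftrightarrow> c \<le> c'"
  using shrink_affine[of u c] shrink_affine[of u c'] by (simp add: divide_le_cancel)

lemma shrink_bounds: "0 \<le> c \<Longrightarrow> c \<le> 1 \<Longrightarrow> 0 \<le> shrink u c \<and> shrink u c \<le> 1"
  by (induction u) auto

lemma shrink_Cantor: "c \<in> Cantor \<Longrightarrow> shrink u c \<in> Cantor"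
proof (induction u)
  case (Cons b u)
  then show ?case
    using Cantor_iff[of "shrink (b # u) c"] Cantor_bounds[of "shrink u c"] by (cases b) auto
qed simp

lemma zero_one_Cantor: "0 \<in> Cantor" "1 \<in> Cantor"
proof -
  have "0 \<in> cantor_approx n" "1 \<in> cantor_approx n" for n
    by (induction n) (simp_all add: cantor_approx_Suc_iff del: cantor_approx.simps(2))
  then show "0 \<in> Cantor" "1 \<in> Cantor" by (auto simp: Cantor_def)
qed

text \<open>The end points are included here: a triadic interval meets the Cantor set only in its own scaled
  copy, because different intervals of the same length in the construction are disjoint.\<close>

lemma Cantor_within_shrink:
  "c \<in> Cantor \<Longrightarrow> shrink u 0 \<le> c \<Longrightarrow> c \<le> shrink u 1 \<Longrightarrow> \<exists>c'\<in>Cantor. c = shrink u c'"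
proof (induction u arbitrary: c)
  case (Cons b u)
  let ?c = "3 * c - (if b then 2 else 0)"
  have bounds: "0 \<le> shrink u 0" "shrink u 1 \<le> 1" using shrink_bounds by auto
  have "?c \<in> Cantor"
    using Cons.prems bounds Cantor_iff[of c] by (cases b) auto
  moreover have "shrink u 0 \<le> ?c" "?c \<le> shrink u 1" using Cons.prems by (cases b; simp)+
  ultimately obtain c' where "c' \<in> Cantor" "?c = shrink u c'" using Cons.IH by blast
  moreover have "c = shrink (b # u) c'" using calculation(2) by (cases b) auto
  ultimately show ?case by blast
qed auto

lemma shrink_determines:
  "shrink u 0 = shrink w 0 \<Longrightarrow> shrink u 1 = shrink w 1 \<Longrightarrow> u = w"
proof (induction u arbitrary: w)
  case Nil
  then have "(3 :: real) ^ length w = 1" using shrink_affine[of w 1] by simp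
  then show ?case using one_less_power[of "3 :: real" "length w"] by auto
next
  case (Cons b u)
  show ?case
  proof (cases w)
    case Nil
    have "(3 :: real) ^ length (b # u) = 1"
      using Cons.prems Nil shrink_affine[of "b # u" 1] by (simp del: shrink.simps(2))
    then show ?thesis using one_less_power[of "3 :: real" "length (b # u)"] by (simp del: power_Suc)
  next
    case w: (Cons c w')
    have "0 \<le> shrink u 0 \<and> shrink u 0 \<le> 1" "0 \<le> shrink w' 0 \<and> shrink w' 0 \<le> 1"
      using shrink_bounds by auto
    then have "b = c" using Cons.prems(1) w by (cases b; cases c) auto
    then show ?thesis using Cons.IH[of w'] Cons.prems w by auto
  qed
qed

section \<open>Numberings acting on the plane\<close>

abbreviation "Cantor2 \<equiv> Cantor \<times> Cantor"

text \<open>The affine map of the unit square onto the rectangle at an address.\<close>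

definition place :: "address \<Rightarrow> point \<Rightarrow> point" where
  "place r p = (2 * real (fst r) + shrink (snd r True) (fst p), shrink (snd r False) (snd p))"

definition rect :: "address \<Rightarrow> point set" where
  "rect r = {2 * real (fst r) + shrink (snd r True) 0 .. 2 * real (fst r) + shrink (snd r True) 1}
    \<times> {shrink (snd r False) 0 .. shrink (snd r False) 1}"

definition shrink2 :: "address \<Rightarrow> point \<Rightarrow> point" where
  "shrink2 r p = (shrink (snd r True) (fst p), shrink (snd r False) (snd p))"

lemma shrink2_Cantor2: "c \<in> Cantor2 \<Longrightarrow> shrink2 r c \<in> Cantor2"
  by (auto simp: shrink2_def shrink_Cantor)

lemma place_whole: "place r c = place (whole (fst r)) (shrink2 r c)"
  by (simp add: place_def shrink2_def)

lemma place_inside: "place (inside r t) c = place r (shrink2 t c)"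
  by (simp add: place_def shrink2_def shrink_append)

lemma Y_place: "Y = (\<Union>n. place (whole n) ` Cantor2)"
proof -
  have "place (whole n) ` Cantor2 = (\<lambda>x. 2 * real n + x) ` Cantor \<times> Cantor" for n
    unfolding place_def by (auto simp: image_iff)
  then show ?thesis unfolding Y_def by simp
qed

lemma place_in_Y: "c \<in> Cantor2 \<Longrightarrow> place r c \<in> Y"
proof -
  assume "c \<in> Cantor2"
  then have "place (whole (fst r)) (shrink2 r c) \<in> Y"
    unfolding Y_place by (intro UN_I[of "fst r"] UNIV_I imageI shrink2_Cantor2)
  then show ?thesis by (simp flip: place_whole)
qed

lemma Y_cases:
  assumes "p \<in> Y"
  obtains n c where "c \<in> Cantor2" "p = place (whole n) c"
  using assms unfolding Y_place by blast

lemma place_eq: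
  assumes "place r c = place t c'" "c \<in> Cantor2" "c' \<in> Cantor2"
  shows "fst r = fst t \<and> shrink2 r c = shrink2 t c'"
proof -
  have "shrink2 r c \<in> Cantor2" "shrink2 t c' \<in> Cantor2" using assms shrink2_Cantor2 by blast+
  then have "0 \<le> fst (shrink2 r c) \<and> fst (shrink2 r c) \<le> 1" "0 \<le> fst (shrink2 t c') \<and> fst (shrink2 t c') \<le> 1"
    using Cantor_bounds by (auto simp: mem_Times_iff)
  moreover have "2 * real (fst r) + fst (shrink2 r c) = 2 * real (fst t) + fst (shrink2 t c')"
    using assms(1) by (simp add: place_def shrink2_def)
  ultimately have "fst r = fst t" by linarith
  then show ?thesis using assms(1) by (simp add: place_def shrink2_def)
qed

lemma place_whole_eq_iff:
  "c \<in> Cantor2 \<Longrightarrow> c' \<in> Cantor2 \<Longrightarrow> place (whole n) c = place (whole m) c' \<longleftrightarrow> n = m \<and> c = c'"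
  using place_eq[of "whole n" c "whole m" c'] by (auto simp: shrink2_def prod_eq_iff)

lemma shrink2_eq_iff [simp]: "shrink2 r c = shrink2 r c' \<longleftrightarrow> c = c'"
  by (auto simp: shrink2_def prod_eq_iff)

text \<open>The images of two opposite corners determine the position and the size in each direction.\<close>

lemma place_determines:
  assumes "\<And>c. c \<in> Cantor2 \<Longrightarrow> place r c = place t c"
  shows "r = t"
proof -
  have "(0, 0) \<in> Cantor2" "(1, 1) \<in> Cantor2" using zero_one_Cantor by auto
  then have "fst r = fst t" "shrink2 r (0, 0) = shrink2 t (0, 0)" "shrink2 r (1, 1) = shrink2 t (1, 1)"
    using assms place_eq by blast+
  then have "snd r d = snd t d" for d
    using shrink_determines[of "snd r d" "snd t d"] by (cases d) (auto simp: shrink2_def)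
  with \<open>fst r = fst t\<close> show ?thesis by (auto simp: prod_eq_iff)
qed

lemma Y_Int_rect: "Y \<inter> rect r = place r ` Cantor2"
proof
  show "place r ` Cantor2 \<subseteq> Y \<inter> rect r"
    using place_in_Y Cantor_bounds by (fastforce simp: place_def rect_def)
  show "Y \<inter> rect r \<subseteq> place r ` Cantor2"
  proof
    fix p assume p: "p \<in> Y \<inter> rect r"
    then obtain n c where c: "c \<in> Cantor2" "p = place (whole n) c" using Y_cases by blast
    have x: "2 * real (fst r) + shrink (snd r True) 0 \<le> 2 * real n + fst c"
      "2 * real n + fst c \<le> 2 * real (fst r) + shrink (snd r True) 1"
      and y: "shrink (snd r False) 0 \<le> snd c" "snd c \<le> shrink (snd r False) 1"
      using p c by (auto simp: rect_def place_def)
    have "0 \<le> fst c \<and> fst c \<le> 1" using c(1) Cantor_bounds by (auto simp: mem_Times_iff)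
    moreover have "0 \<le> shrink (snd r True) 0" "shrink (snd r True) 1 \<le> 1" using shrink_bounds by auto
    ultimately have n: "n = fst r" using x by linarith
    obtain a b where "a \<in> Cantor" "fst c = shrink (snd r True) a" "b \<in> Cantor" "snd c = shrink (snd r False) b"
      using Cantor_within_shrink[of "fst c" "snd r True"] Cantor_within_shrink[of "snd c" "snd r False"]
        x y n c(1) by (auto simp: mem_Times_iff)
    then have "p = place r (a, b)" "(a, b) \<in> Cantor2" using c n by (auto simp: place_def)
    then show "p \<in> place r ` Cantor2" by blast
  qed
qed

lemma rect_bounds_eq:
  "{a..b} \<times> {c..d} = rect r \<longleftrightarrow> a = 2 * real (fst r) + shrink (snd r True) 0
    \<and> b = 2 * real (fst r) + shrink (snd r True) 1
    \<and> c = shrink (snd r False) 0 \<and> d = shrink (snd r False) 1"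
  by (auto simp: rect_def times_eq_iff)

lemma inj_rect: "rect r = rect t \<Longrightarrow> r = t"
proof -
  assume eq: "rect r = rect t"
  then have "place r ` Cantor2 = place t ` Cantor2" by (simp flip: Y_Int_rect)
  then obtain c c' where "place r c = place t c'" "c \<in> Cantor2" "c' \<in> Cantor2"
    using zero_one_Cantor by blast
  then have "fst r = fst t" using place_eq by blast
  moreover have "snd r d = snd t d" for d
    using eq calculation shrink_determines[of "snd r d" "snd t d"]
    unfolding rect_def[of r] rect_bounds_eq by (cases d) auto
  ultimately show ?thesis by (auto simp: prod_eq_iff)
qed

lemma rect_whole: "rect (whole n) = Sq n"
  by (simp add: rect_def Sq_def)

lemma rect_cut_True: "rect \<circ> cut_numbering True i = v_pattern i"
  by (rule ext) (auto simp: v_pattern_def cut_numbering_def rect_whole, auto simp: rect_def)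

lemma rect_cut_False: "rect \<circ> cut_numbering False i = h_pattern i"
  by (rule ext) (auto simp: h_pattern_def cut_numbering_def rect_whole, auto simp: rect_def)

lemma rect_swap: "rect \<circ> swap_numbering i = \<sigma>_pattern i"
  by (rule ext) (auto simp: \<sigma>_pattern_def swap_numbering_def perm_numbering_def rect_whole transpose_def)

definition column :: "point \<Rightarrow> nat" where
  "column p = nat \<lfloor>fst p / 2\<rfloor>"

text \<open>The map that takes the part of \<^const>\<open>Y\<close> in \<open>S\<^sub>n\<close> affinely onto its part in the rectangle with number
  \<open>n\<close>. For numbered patterns it is the homeomorphism that the pattern stands for (\<open>elt_numbering\<close>).\<close>

definition act :: "(nat \<Rightarrow> address) \<Rightarrow> point \<Rightarrow> point" where
  "act A = (\<lambda>p\<in>Y. place (A (column p)) (fst p - 2 * real (column p), snd p))"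

lemma act_extensional: "act A \<in> extensional Y"
  by (simp add: act_def)

lemma act_whole:
  assumes "c \<in> Cantor2"
  shows "act A (place (whole n) c) = place (A n) c"
proof -
  have "0 \<le> fst c \<and> fst c \<le> 1" using assms Cantor_bounds by (auto simp: mem_Times_iff)
  then have "column (place (whole n) c) = n"
    unfolding column_def place_def by (simp add: floor_eq_iff nat_eq_iff)
  then show ?thesis using place_in_Y[OF assms] by (simp add: act_def) (simp add: place_def)
qed

lemma act_place: "c \<in> Cantor2 \<Longrightarrow> act A (place r c) = place (inside (A (fst r)) r) c"
  by (subst place_whole) (simp add: act_whole shrink2_Cantor2 place_inside)

lemma act_in_Y: "p \<in> Y \<Longrightarrow> act A p \<in> Y"
  by (auto elim!: Y_cases simp: act_whole place_in_Y)

lemma act_after: "compose Y (act A) (act B) = act (A \<Zsemi> B)"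
proof (rule extensionalityI[of _ Y])
  fix p assume "p \<in> Y"
  then show "compose Y (act A) (act B) p = act (A \<Zsemi> B) p"
    by (auto elim!: Y_cases simp: compose_eq act_whole act_place after_apply)
qed (auto simp: act_extensional)

lemma act_id: "act whole = (\<lambda>p\<in>Y. p)"
  by (rule extensionalityI[of _ Y]) (auto elim!: Y_cases simp: act_extensional act_whole place_in_Y)

lemma act_inj: "act A = act B \<Longrightarrow> A = B"
  by (rule ext, rule place_determines) (metis act_whole)

text \<open>Bijectivity amounts to the self-similarity of the Cantor set: it is the disjoint union of its
  left and right thirds.\<close>

lemma act_cut_Bij: "act (cut_numbering d i) \<in> Bij Y"
proof -
  have "inj_on (act (cut_numbering d i)) Y"
  proof (rule inj_onI)
    fix p q assume "p \<in> Y" "q \<in> Y" and eq: "act (cut_numbering d i) p = act (cut_numbering d i) q"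
    then obtain n c m c' where pq: "c \<in> Cantor2" "p = place (whole n) c"
      "c' \<in> Cantor2" "q = place (whole m) c'" by (metis Y_cases)
    have "place (cut_numbering d i n) c = place (cut_numbering d i m) c'"
      using eq pq by (simp add: act_whole)
    note cut_eq = place_eq[OF this pq(1,3)]
    have "0 \<le> fst c \<and> fst c \<le> 1 \<and> 0 \<le> snd c \<and> snd c \<le> 1"
      "0 \<le> fst c' \<and> fst c' \<le> 1 \<and> 0 \<le> snd c' \<and> snd c' \<le> 1"
      using pq(1,3) Cantor_bounds by (auto simp: mem_Times_iff)
    then have sep: "shrink2 (half d False k) c \<noteq> shrink2 (half d True l) c'
      \<and> shrink2 (half d True k) c \<noteq> shrink2 (half d False l) c'" for k l
      by (cases d) (auto simp: shrink2_def)
    have w: "shrink2 (whole k) a = a" for k a by (simp add: shrink2_def)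
    have "n = m \<and> c = c'"
      using cut_eq sep
      by (cases n i rule: position_cases; cases m i rule: position_cases) (simp_all add: w)
    then show "p = q" using pq by simp
  qed
  moreover have "act (cut_numbering d i) ` Y = Y"
  proof
    show "act (cut_numbering d i) ` Y \<subseteq> Y" using act_in_Y by blast
    show "Y \<subseteq> act (cut_numbering d i) ` Y"
    proof
      fix p assume "p \<in> Y"
      then obtain n c where p: "c \<in> Cantor2" "p = place (whole n) c" by (rule Y_cases)
      have "\<exists>m c'. c' \<in> Cantor2 \<and> place (cut_numbering d i m) c' = p"
      proof -
        consider "n < i" | "n = i" | "i < n" by linarith
        then show ?thesis
        proof cases
          case 1
          then show ?thesis using p by (intro exI[of _ n] exI[of _ c]) auto
        next
          case 3
          then show ?thesis using p by (intro exI[of _ "Suc n"] exI[of _ c]) auto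
        next
          case 2
          let ?c = "if d then fst c else snd c"
          have "?c \<in> Cantor" using p(1) by auto
          then obtain b a where a: "a \<in> Cantor" "?c = shrink [b] a"
          proof -
            from \<open>?c \<in> Cantor\<close> consider "3 * ?c \<in> Cantor" | "3 * ?c - 2 \<in> Cantor"
              using Cantor_iff by blast
            then show ?thesis
              by cases (rule that[of "3 * ?c" False], simp_all, rule that[of "3 * ?c - 2" True],
                simp_all add: diff_divide_distrib)
          qed
          let ?c' = "if d then (a, snd c) else (fst c, a)"
          have "?c' \<in> Cantor2" using a p(1) by auto
          moreover have "place (half d b i) ?c' = p"
            using a(2) p(2) 2 by (auto simp: place_def split: if_splits)
          moreover have "cut_numbering d i (if b then Suc i else i) = half d b i" by (cases b) auto
          ultimately show ?thesis by metis
        qed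
      qed
      then obtain m c' where c': "c' \<in> Cantor2" "place (cut_numbering d i m) c' = p" by blast
      then have "p = act (cut_numbering d i) (place (whole m) c')" by (simp add: act_whole)
      then show "p \<in> act (cut_numbering d i) ` Y" using place_in_Y[OF c'(1)] by blast
    qed
  qed
  ultimately show ?thesis by (simp add: Bij_def bij_betw_def act_extensional)
qed

lemma act_swap_Bij: "act (swap_numbering i) \<in> Bij Y"
proof -
  have "swap_numbering i \<Zsemi> swap_numbering i = whole"
    using N.square[of i] by simp
  then have "act (swap_numbering i) (act (swap_numbering i) p) = p" if "p \<in> Y" for p
    using act_after[of "swap_numbering i" "swap_numbering i"] act_id that by (metis compose_eq restrict_apply)
  then have "bij_betw (act (swap_numbering i)) Y Y"
    by (intro bij_betw_byWitness[where f' = "act (swap_numbering i)"]) (auto intro: act_in_Y)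
  then show ?thesis by (simp add: Bij_def act_extensional)
qed

abbreviation bijections :: "(point \<Rightarrow> point) monoid" where
  "bijections \<equiv> BijGroup Y"

lemma bijections_mult:
  "f \<in> Bij Y \<Longrightarrow> g \<in> Bij Y \<Longrightarrow> f \<otimes>\<^bsub>bijections\<^esub> g = compose Y f g"
  by (simp add: BijGroup_def)

lemma bijections_carrier: "carrier bijections = Bij Y"
  by (simp add: BijGroup_def)

lemma act_mult:
  "act A \<in> Bij Y \<Longrightarrow> act B \<in> Bij Y \<Longrightarrow> act A \<otimes>\<^bsub>bijections\<^esub> act B = act (A \<Zsemi> B)"
  by (simp add: bijections_mult act_after)

lemma act_gen_Bij: "act (numbering_gen k i) \<in> Bij Y"
  by (cases k) (simp_all add: act_cut_Bij act_swap_Bij)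

lemma act_Bij: "N.positive n A \<Longrightarrow> act A \<in> Bij Y"
proof (induction rule: N.positive.induct)
  case one
  show ?case by (simp only: numberings_simps act_id id_Bij)
next
  case (swap n A i)
  then show ?case using compose_Bij[OF act_swap_Bij swap.IH] by (simp add: act_after)
next
  case (cut n A d i)
  then show ?case using compose_Bij[OF act_cut_Bij cut.IH] by (simp add: act_after)
qed

section \<open>Numbered patterns\<close>

text \<open>Products of cuts and swaps. It is shown below that they encode exactly the numbered patterns.\<close>

definition numbering :: "(nat \<Rightarrow> address) \<Rightarrow> bool" where
  "numbering A \<longleftrightarrow> (\<exists>n. N.positive n A)"

lemma numbering_after: "numbering A \<Longrightarrow> numbering B \<Longrightarrow> numbering (A \<Zsemi> B)"
  unfolding numbering_def using N.positive_mult by fastforce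

lemma numbering_whole: "numbering whole"
  unfolding numbering_def using N.positive.one by auto

lemma numbering_generator: "numbering (numbering_gen k i)"
  unfolding numbering_def using N.positive_x N.positive_s by (cases k) blast+

lemma numbering_Bij: "numbering A \<Longrightarrow> act A \<in> Bij Y"
  unfolding numbering_def using act_Bij by blast

text \<open>Bijectivity of the action says that the parts of \<^const>\<open>Y\<close> in the rectangles of a numbering
  are disjoint and cover \<^const>\<open>Y\<close>; this lemma and the next one make the two halves of this explicit.\<close>

lemma numbering_disjoint:
  assumes "numbering A" "c \<in> Cantor2" "c' \<in> Cantor2" "place (A n) c = place (A m) c'"
  shows "n = m \<and> c = c'"
proof -
  have "inj_on (act A) Y" using numbering_Bij[OF assms(1)] by (simp add: Bij_def bij_betw_def)
  moreover have "act A (place (whole n) c) = act A (place (whole m) c')"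
    using assms by (simp add: act_whole)
  ultimately have "place (whole n) c = place (whole m) c'"
    using assms(2,3) place_in_Y by (blast dest: inj_onD)
  then show ?thesis using assms(2,3) by (simp add: place_whole_eq_iff)
qed

lemma numbering_cover:
  assumes "numbering A" "p \<in> Y"
  obtains n c where "c \<in> Cantor2" "p = place (A n) c"
proof -
  have "act A ` Y = Y" using numbering_Bij[OF assms(1)] by (simp add: Bij_def bij_betw_def)
  then obtain q where "q \<in> Y" "p = act A q" using assms(2) by blast
  moreover obtain n c where "c \<in> Cantor2" "q = place (whole n) c" using \<open>q \<in> Y\<close> by (rule Y_cases)
  ultimately show thesis using that act_whole by blast
qed

lemma numbering_inj_rect: "numbering A \<Longrightarrow> inj (rect \<circ> A)"
proof (rule injI)
  fix n m assume "numbering A" "(rect \<circ> A) n = (rect \<circ> A) m"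
  moreover from this have "A n = A m" by (simp add: inj_rect)
  ultimately show "n = m"
    using numbering_disjoint[of A "(0, 0)" "(0, 0)" n m] zero_one_Cantor by auto
qed

text \<open>Multiplying by a cut on the right is a simple increment of the pattern.\<close>

lemma range_cut:
  assumes "inj (rect \<circ> A)"
  shows "range (rect \<circ> (A \<Zsemi> cut_numbering d n)) = (range (rect \<circ> A) - {rect (A n)})
    \<union> {rect (inside (A n) (half d False n)), rect (inside (A n) (half d True n))}"
    (is "range ?f = ?R")
proof
  have other: "rect (A m) \<in> ?R" if "m \<noteq> n" for m
    using that injD[OF assms, of m n] by auto
  show "range ?f \<subseteq> ?R"
  proof (rule image_subsetI)
    fix k
    show "?f k \<in> ?R"
      by (cases k n rule: position_cases) (use other in \<open>auto simp: after_apply\<close>)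
  qed
  have kept: "rect (A m) \<in> range ?f" if "m \<in> - {n}" for m
  proof (cases "m < n")
    case True
    then have "rect (A m) = ?f m" by (simp add: after_apply)
    then show ?thesis by (rule range_eqI)
  next
    case False
    then have "rect (A m) = ?f (Suc m)" using that by (simp add: after_apply)
    then show ?thesis by (rule range_eqI)
  qed
  have "rect (inside (A n) (half d False n)) \<in> range ?f"
    by (rule range_eqI[of _ _ n]) (simp add: after_apply)
  moreover have "rect (inside (A n) (half d True n)) \<in> range ?f"
    by (rule range_eqI[of _ _ "Suc n"]) (simp add: after_apply)
  moreover have "range (rect \<circ> A) - {rect (A n)} = (\<lambda>m. rect (A m)) ` (- {n})"
    using injD[OF assms] by fastforce
  then have "range (rect \<circ> A) - {rect (A n)} \<subseteq> range ?f"
    by (simp only: image_subset_iff) (intro ballI kept)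
  ultimately show "?R \<subseteq> range ?f" by (simp only: Un_subset_iff insert_subset empty_subsetI simp_thms)
qed

lemma shrink_thirds:
  "shrink (u @ [False]) c = shrink u 0 + (shrink u c - shrink u 0) / 3"
  "shrink (u @ [True]) c = shrink u 1 - (shrink u 1 - shrink u c) / 3"
proof -
  define r :: real where "r = 1 / 3 ^ length u"
  have affine: "shrink u y = shrink u 0 + y * r" for y
    using shrink_affine[of u y] by (simp add: r_def)
  show "shrink (u @ [False]) c = shrink u 0 + (shrink u c - shrink u 0) / 3"
    using affine[of "c / 3"] affine[of c] by (simp add: shrink_append)
  show "shrink (u @ [True]) c = shrink u 1 - (shrink u 1 - shrink u c) / 3"
    using affine[of "2 / 3 + c / 3"] affine[of c] affine[of 1]
    by (simp add: shrink_append field_simps)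
qed

lemma rect_halves:
  assumes "{a..b} \<times> {c..d} = rect r"
  shows "rect (inside r (half True False i)) = {a .. a + (b - a) / 3} \<times> {c..d}"
    "rect (inside r (half True True i)) = {b - (b - a) / 3 .. b} \<times> {c..d}"
    "rect (inside r (half False False i)) = {a..b} \<times> {c .. c + (d - c) / 3}"
    "rect (inside r (half False True i)) = {a..b} \<times> {d - (d - c) / 3 .. d}"
  using assms[unfolded rect_bounds_eq]
  by (simp_all add: rect_def shrink_thirds algebra_simps)

lemma pattern_numbering:
  "pattern \<P> \<Longrightarrow> \<exists>A. numbering A \<and> \<P> = range (rect \<circ> A)"
proof (induction rule: pattern.induct)
  case trivial
  have "rect \<circ> whole = Sq" by (simp add: fun_eq_iff rect_whole)
  then show ?case using numbering_whole by metis
next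
  case (vertical \<P> a b c d)
  then obtain A where A: "numbering A" "\<P> = range (rect \<circ> A)" by blast
  then obtain n where n: "{a..b} \<times> {c..d} = rect (A n)" using vertical.hyps(2) by auto
  have "numbering (A \<Zsemi> cut_numbering True n)"
    using numbering_after[OF A(1) numbering_generator[of "Some True" n]] by simp
  moreover note range_cut[OF numbering_inj_rect[OF A(1)], of True n, folded A(2),
    unfolded rect_halves[OF n], folded n]
  ultimately show ?case by metis
next
  case (horizontal \<P> a b c d)
  then obtain A where A: "numbering A" "\<P> = range (rect \<circ> A)" by blast
  then obtain n where n: "{a..b} \<times> {c..d} = rect (A n)" using horizontal.hyps(2) by auto
  have "numbering (A \<Zsemi> cut_numbering False n)"
    using numbering_after[OF A(1) numbering_generator[of "Some False" n]] by simp
  moreover note range_cut[OF numbering_inj_rect[OF A(1)], of False n, folded A(2),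
    unfolded rect_halves[OF n], folded n]
  ultimately show ?case by metis
qed

lemma numbering_pattern:
  assumes "numbering A"
  shows "pattern (range (rect \<circ> A))"
proof -
  from assms obtain n where "N.positive n A" unfolding numbering_def by blast
  then show ?thesis
  proof (induction rule: N.positive_right_induct)
    case one
    have "rect \<circ> whole = Sq" by (simp add: fun_eq_iff rect_whole)
    then show ?case using pattern.trivial by simp
  next
    case (swap A n i)
    have "rect \<circ> (A \<Zsemi> swap_numbering i) = (rect \<circ> A) \<circ> Transposition.transpose i (Suc i)"
      by (simp add: fun_eq_iff after_apply swap_numbering_def perm_numbering_def)
    moreover have "range ((rect \<circ> A) \<circ> Transposition.transpose i (Suc i)) = range (rect \<circ> A)"
      by (simp only: image_comp[symmetric] surj_transpose)
    ultimately show ?case using swap by simp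
  next
    case (cut A n d i)
    have inj: "inj (rect \<circ> A)" using cut(1) by (intro numbering_inj_rect) (auto simp: numbering_def)
    obtain a b c e where r: "{a..b} \<times> {c..e} = rect (A i)" using rect_def by blast
    then have "{a..b} \<times> {c..e} \<in> range (rect \<circ> A)" by auto
    then show ?case
      using pattern.vertical[OF cut(2)] pattern.horizontal[OF cut(2)] range_cut[OF inj, of d i]
      by (cases d) (auto simp only: rect_halves[OF r] r[symmetric] numbering_gen.simps numberings_simps)
  qed
qed

lemma numbering_eventually:
  assumes "numbering A"
  shows "\<exists>j k. \<forall>i\<ge>k. A (i + j) = whole i"
proof -
  from assms obtain n where "N.positive n A" unfolding numbering_def by blast
  then show ?thesis
  proof (induction rule: N.positive.induct)
    case one
    have "whole (i + 0) = whole i" for i by simp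
    then show ?case unfolding numberings_simps by blast
  next
    case (swap n A l)
    then obtain j k where jk: "\<forall>i\<ge>k. A (i + j) = whole i" by blast
    have "(swap_numbering l \<Zsemi> A) (i + j) = whole i" if "i \<ge> k + Suc (Suc l)" for i
      using that jk by (simp add: after_apply)
    then show ?case unfolding numberings_simps numbering_gen.simps by blast
  next
    case (cut n A d l)
    then obtain j k where jk: "\<forall>i\<ge>k. A (i + j) = whole i" by blast
    have "(cut_numbering d l \<Zsemi> A) (i + Suc j) = whole i" if "i \<ge> k + Suc l" for i
      using that jk[rule_format, of "Suc i"] by (simp add: after_apply)
    then show ?case unfolding numberings_simps numbering_gen.simps by blast
  qed
qed

text \<open>Any other rectangle inside \<open>S\<^sub>i\<close> would share a point of \<^const>\<open>Y\<close> with it.\<close>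

lemma whole_piece_unique:
  assumes "numbering A" "A m = whole i"
  shows "{R \<in> range (rect \<circ> A). R \<subseteq> Sq i} = {rect (A m)}"
proof -
  have "n = m" if sub: "rect (A n) \<subseteq> Sq i" for n
  proof -
    have "place (A n) (0, 0) \<in> Y \<inter> rect (A n)" using zero_one_Cantor unfolding Y_Int_rect by blast
    then have "place (A n) (0, 0) \<in> Y \<inter> rect (A m)" using sub assms(2) rect_whole by auto
    then obtain c where "c \<in> Cantor2" "place (A n) (0, 0) = place (A m) c"
      unfolding Y_Int_rect by blast
    then show ?thesis using numbering_disjoint[OF assms(1), of "(0, 0)" c n m] zero_one_Cantor by auto
  qed
  moreover have "rect (A m) \<in> range (rect \<circ> A)" by auto
  ultimately show ?thesis using assms(2) rect_whole by auto
qed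

lemma numbering_numbered_pattern:
  assumes "numbering A"
  shows "numbered_pattern (rect \<circ> A)"
proof -
  obtain j k where jk: "\<forall>i\<ge>k. A (i + j) = whole i" using numbering_eventually[OF assms] by blast
  have "{R \<in> range (rect \<circ> A). R \<subseteq> Sq i} = {(rect \<circ> A) (i + j)}" if "i > k" for i
    using whole_piece_unique[OF assms, of "i + j" i] jk that by simp
  moreover have "bij_betw (rect \<circ> A) UNIV (range (rect \<circ> A))"
    using numbering_inj_rect[OF assms] by (rule inj_on_imp_bij_betw)
  ultimately show ?thesis unfolding numbered_pattern_def using numbering_pattern[OF assms] by blast
qed

lemma perm_numbering_after: "perm_numbering f \<Zsemi> perm_numbering g = perm_numbering (f \<circ> g)"
  by (simp add: fun_eq_iff after_apply perm_numbering_def)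

text \<open>A transposition of distant numbers is conjugate to one of closer numbers by an adjacent swap.\<close>

lemma numbering_transpose:
  "numbering (perm_numbering (Transposition.transpose a (a + Suc m)))"
proof (induction m)
  case 0
  then show ?case using numbering_generator[of None a] by (simp add: swap_numbering_def)
next
  case (Suc m)
  let ?b = "a + Suc m"
  have "perm_numbering (Transposition.transpose a (Suc ?b))
      = swap_numbering ?b \<Zsemi> (perm_numbering (Transposition.transpose a ?b) \<Zsemi> swap_numbering ?b)"
    unfolding swap_numbering_def perm_numbering_after
    by (rule arg_cong[of _ _ perm_numbering]) (auto simp: fun_eq_iff transpose_def)
  then show ?case
    using Suc numbering_generator[of None ?b] by (simp add: numbering_after)
qed

lemma numbering_perm:
  assumes "f permutes S" "finite S"
  shows "numbering (perm_numbering f)"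
  using assms
proof (induction rule: permutes_induct)
  case id
  have "perm_numbering id = whole" by (simp add: fun_eq_iff perm_numbering_def)
  then show ?case using numbering_whole by metis
next
  case (swap a b p)
  have "numbering (perm_numbering (Transposition.transpose a b))"
  proof -
    have "\<exists>m. b = a + Suc m \<or> a = b + Suc m" using swap(3) by (metis add_Suc_right less_imp_Suc_add linorder_neqE_nat)
    then show ?thesis using numbering_transpose by (metis transpose_commute)
  qed
  then show ?case using swap.IH numbering_after perm_numbering_after by metis
qed

text \<open>The pattern comes from some numbering \<open>A\<close>, and \<open>P\<close> differs from it by a bijection \<open>f\<close> of the
  numbers. For large numbers \<open>f\<close> is a translation because both numberings are regular there; counting
  the remaining numbers shows that the translation is trivial. So \<open>f\<close> is a finitary permutation, which
  is a product of swaps.\<close>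

lemma numbered_pattern_numbering:
  assumes "numbered_pattern P"
  obtains A where "numbering A" "P = rect \<circ> A"
proof -
  from assms obtain \<P> j k where P: "pattern \<P>" "bij_betw P UNIV \<P>"
    "\<And>i. i > k \<Longrightarrow> {R \<in> \<P>. R \<subseteq> Sq i} = {P (i + j)}"
    unfolding numbered_pattern_def by blast
  obtain A where A: "numbering A" "\<P> = range (rect \<circ> A)" using pattern_numbering[OF P(1)] by blast
  obtain j' k' where A_end: "\<And>i. i \<ge> k' \<Longrightarrow> A (i + j') = whole i"
    using numbering_eventually[OF A(1)] by blast
  define f where "f n = inv_into UNIV (rect \<circ> A) (P n)" for n
  have inj: "inj (rect \<circ> A)" by (rule numbering_inj_rect[OF A(1)])
  have P_f: "P n = rect (A (f n))" for n
  proof -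
    have "P n \<in> range (rect \<circ> A)" using bij_betw_apply[OF P(2), of n] A(2) by simp
    from f_inv_into_f[OF this] show ?thesis unfolding f_def by simp
  qed
  have "bij f"
  proof -
    have "bij_betw (inv_into UNIV (rect \<circ> A)) (range (rect \<circ> A)) UNIV"
      by (rule bij_betw_inv_into) (rule inj_on_imp_bij_betw[OF inj])
    from bij_betw_trans[OF P(2)[unfolded A(2)] this] show ?thesis
      by (simp add: f_def[abs_def] comp_def)
  qed
  define l where "l = Suc (k + k')"
  have f_end: "f (i + j) = i + j'" if "i \<ge> l" for i
  proof -
    have "{rect (A (i + j'))} = {P (i + j)}"
      using whole_piece_unique[OF A(1) A_end, of i] P(3)[of i] A(2) that unfolding l_def by simp
    then have "rect (A (f (i + j))) = rect (A (i + j'))" using P_f by auto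
    then show ?thesis using injD[OF inj] by auto
  qed
  have image: "f ` {l + j..} = {l + j'..}"
  proof -
    have shift: "{l + m..} = (\<lambda>i. i + m) ` {l..}" for m
      using image_add_atLeast[of m l] by (simp add: add.commute)
    have "f ` {l + j..} = f ` ((\<lambda>i. i + j) ` {l..})" unfolding shift ..
    also have "\<dots> = (\<lambda>i. i + j') ` {l..}" unfolding image_image by (rule image_cong) (use f_end in auto)
    finally show ?thesis unfolding shift .
  qed
  have "f ` {..<l + j} = {..<l + j'}"
  proof -
    have "f ` (- {l + j..}) = - f ` {l + j..}" by (rule bij_image_Compl_eq[OF \<open>bij f\<close>])
    moreover have "- {l + j..} = {..<l + j}" "- {l + j'..} = {..<l + j'}" by auto
    ultimately show ?thesis using image by simp
  qed
  moreover from this have "card {..<l + j} = card {..<l + j'}"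
    using card_image[OF inj_on_subset[OF bij_is_inj[OF \<open>bij f\<close>] subset_UNIV]] by metis
  \<comment> \<open>a bijection between initial segments forces them to have the same length\<close>
  ultimately have "j = j'" "f ` {..<l + j} = {..<l + j}" by auto
  have "f permutes {..<l + j}"
  proof (rule bij_imp_permutes)
    show "bij_betw f {..<l + j} {..<l + j}"
      using \<open>f ` {..<l + j} = {..<l + j}\<close> bij_is_inj[OF \<open>bij f\<close>]
      by (auto simp: bij_betw_def intro: inj_on_subset)
    show "f n = n" if "n \<notin> {..<l + j}" for n
      using f_end[of "n - j"] that \<open>j = j'\<close> by auto
  qed
  then have "numbering (A \<Zsemi> perm_numbering f)"
    using numbering_after[OF A(1) numbering_perm] by blast
  moreover have "P = rect \<circ> (A \<Zsemi> perm_numbering f)"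
    using P_f by (simp add: fun_eq_iff after_apply perm_numbering_def)
  ultimately show thesis by (rule that)
qed

section \<open>The homeomorphism of a pair of numbered patterns\<close>

text \<open>The minimum and the maximum of the image are the images of 0 and 1.\<close>

lemma affine_image_Cantor:
  fixes e e' :: real
  assumes "(\<lambda>c. a + e * c) ` Cantor = (\<lambda>c. a' + e' * c) ` Cantor" "e > 0" "e' > 0"
  shows "a = a' \<and> e = e'"
proof -
  have bounds: "b \<le> y \<and> y \<le> b + r" if "y \<in> (\<lambda>c. b + r * c) ` Cantor" "r > 0" for b r y :: real
    using that Cantor_bounds by (auto simp: mult_left_le)
  have ends: "b \<in> (\<lambda>c. b + r * c) ` Cantor" "b + r \<in> (\<lambda>c. b + r * c) ` Cantor" for b r :: real
    using zero_one_Cantor by force+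
  have "a' \<le> a" "a + e \<le> a' + e'"
    using bounds[OF _ assms(3)] ends[of a e] unfolding assms(1) by blast+
  moreover have "a \<le> a'" "a' + e' \<le> a + e"
    using bounds[OF _ assms(2)] ends[of a' e'] unfolding assms(1)[symmetric] by blast+
  ultimately show ?thesis by auto
qed

text \<open>The scaling factors are positive, so an affine map of the given form is determined by the
  rectangle it maps onto.\<close>

lemma rescale_unique:
  assumes image: "f ` (place r ` Cantor2) = place t ` Cantor2"
    and affine: "\<forall>x y. (x, y) \<in> place r ` Cantor2
      \<longrightarrow> f (x, y) = (a + 3 powi j * x, b + 3 powi k * (y :: real))"
    and "c \<in> Cantor2"
  shows "f (place r c) = place t c"
proof -
  define a1 e1 :: real where "a1 = a + 3 powi j * (2 * real (fst r) + shrink (snd r True) 0)"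
    and "e1 = 3 powi j / 3 ^ length (snd r True)"
  define a2 e2 :: real where "a2 = b + 3 powi k * shrink (snd r False) 0"
    and "e2 = 3 powi k / 3 ^ length (snd r False)"
  define a3 e3 :: real where "a3 = 2 * real (fst t) + shrink (snd t True) 0"
    and "e3 = 1 / 3 ^ length (snd t True)"
  define a4 e4 :: real where "a4 = shrink (snd t False) 0" and "e4 = 1 / 3 ^ length (snd t False)"
  have f: "f (place r (c1, c2)) = (a1 + e1 * c1, a2 + e2 * c2)"
    if "c1 \<in> Cantor" "c2 \<in> Cantor" for c1 c2
  proof -
    have "place r (c1, c2) \<in> place r ` Cantor2" using that by blast
    then have "f (place r (c1, c2))
      = (a + 3 powi j * fst (place r (c1, c2)), b + 3 powi k * snd (place r (c1, c2)))"
      using affine by (metis prod.collapse)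
    then show ?thesis
      using shrink_affine[of "snd r True" c1] shrink_affine[of "snd r False" c2]
      by (simp add: place_def a1_def e1_def a2_def e2_def algebra_simps)
  qed
  have p: "place t (c1, c2) = (a3 + e3 * c1, a4 + e4 * c2)" for c1 c2
    using shrink_affine[of "snd t True" c1] shrink_affine[of "snd t False" c2]
    by (simp add: place_def a3_def e3_def a4_def e4_def)
  have "f ` (place r ` Cantor2) = (\<lambda>c. a1 + e1 * c) ` Cantor \<times> (\<lambda>c. a2 + e2 * c) ` Cantor"
    unfolding image_image using f by (force simp: image_iff)
  moreover have "place t ` Cantor2 = (\<lambda>c. a3 + e3 * c) ` Cantor \<times> (\<lambda>c. a4 + e4 * c) ` Cantor"
    using p by (force simp: image_iff)
  ultimately have images: "(\<lambda>c. a1 + e1 * c) ` Cantor = (\<lambda>c. a3 + e3 * c) ` Cantor"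
    "(\<lambda>c. a2 + e2 * c) ` Cantor = (\<lambda>c. a4 + e4 * c) ` Cantor"
    using image zero_one_Cantor(1) by (auto simp: times_eq_iff)
  have pos: "e1 > 0" "e2 > 0" "e3 > 0" "e4 > 0"
    by (simp_all add: e1_def e2_def e3_def e4_def)
  have "a1 = a3 \<and> e1 = e3" "a2 = a4 \<and> e2 = e4"
    using affine_image_Cantor[OF images(1) pos(1,3)] affine_image_Cantor[OF images(2) pos(2,4)] .
  then show ?thesis using f p assms(3) by auto
qed

lemma rescale_affine:
  "\<exists>a b. \<exists>j k :: int. \<forall>c. place t c = (a + 3 powi j * fst (place r c), b + 3 powi k * snd (place r c))"
proof -
  have "\<exists>a. \<exists>j :: int. \<forall>c. m' + shrink u' c = a + 3 powi j * (m + shrink u c)" for m m' :: real and u u'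
  proof -
    let ?j = "int (length u) - int (length u')"
    have scale: "3 powi ?j * (c / 3 ^ length u) = c / 3 ^ length u'" for c :: real
      by (simp add: power_int_diff)
    have "m' + shrink u' c
        = (m' + shrink u' 0 - 3 powi ?j * (m + shrink u 0)) + 3 powi ?j * (m + shrink u c)" for c
      unfolding shrink_affine[of u c] shrink_affine[of u' c] by (simp only: distrib_left scale)
    then show ?thesis by blast
  qed
  note line = this
  obtain a j where "\<And>c. 2 * real (fst t) + shrink (snd t True) c
      = a + 3 powi j * (2 * real (fst r) + shrink (snd r True) c)"
    using line by blast
  moreover obtain b k where "\<And>c. 0 + shrink (snd t False) c = b + 3 powi k * (0 + shrink (snd r False) c)"
    using line by blast
  ultimately show ?thesis unfolding place_def by (intro exI[of _ a] exI[of _ b] exI[of _ j] exI[of _ k]) simp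
qed

text \<open>This discharges the definite description in \<^const>\<open>pair_map\<close>: existence holds because passing from
  one triadic interval to another multiplies lengths by a power of 3, and uniqueness because the
  pieces cover \<^const>\<open>Y\<close>.\<close>

lemma pair_map_eqI:
  assumes B: "numbering B" and \<psi>: "\<psi> \<in> extensional Y"
    and on_pieces: "\<And>n c. c \<in> Cantor2 \<Longrightarrow> \<psi> (place (B n) c) = place (A n) c"
  shows "pair_map (rect \<circ> A) (rect \<circ> B) = \<psi>"
  unfolding pair_map_def
proof (rule the_equality)
  have "\<psi> ` (place (B i) ` Cantor2) = place (A i) ` Cantor2" for i
    unfolding image_image using on_pieces by (rule image_cong[OF refl])
  moreover have "\<exists>a b. \<exists>j k :: int. \<forall>x y. (x, y) \<in> place (B i) ` Cantor2
      \<longrightarrow> \<psi> (x, y) = (a + 3 powi j * x, b + 3 powi k * y)" for i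
  proof -
    obtain a b and j k :: int where
      "\<And>c. place (A i) c = (a + 3 powi j * fst (place (B i) c), b + 3 powi k * snd (place (B i) c))"
      using rescale_affine[of "A i" "B i"] by blast
    note affine = this
    have "\<psi> (x, y) = (a + 3 powi j * x, b + 3 powi k * y)"
      if xy: "(x, y) \<in> place (B i) ` Cantor2" for x y
    proof -
      from xy obtain c where "(x, y) = place (B i) c" "c \<in> Cantor2" by (rule imageE)
      then show ?thesis using on_pieces[of c i] affine[of c] by (metis fst_conv snd_conv)
    qed
    then show ?thesis by blast
  qed
  ultimately show "\<psi> \<in> extensional Y \<and> (\<forall>i. \<psi> ` (Y \<inter> (rect \<circ> B) i) = Y \<inter> (rect \<circ> A) i \<and>
      (\<exists>a b. \<exists>j k :: int. \<forall>x y. (x, y) \<in> Y \<inter> (rect \<circ> B) i \<longrightarrow>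
        \<psi> (x, y) = (a + 3 powi j * x, b + 3 powi k * y)))"
    using \<psi> by (simp add: Y_Int_rect)
next
  fix f
  assume f: "f \<in> extensional Y \<and> (\<forall>i. f ` (Y \<inter> (rect \<circ> B) i) = Y \<inter> (rect \<circ> A) i \<and>
      (\<exists>a b. \<exists>j k :: int. \<forall>x y. (x, y) \<in> Y \<inter> (rect \<circ> B) i \<longrightarrow>
        f (x, y) = (a + 3 powi j * x, b + 3 powi k * y)))"
  have "f (place (B i) c) = place (A i) c" if "c \<in> Cantor2" for i c
  proof -
    note f_i = f[unfolded Y_Int_rect comp_apply, THEN conjunct2, THEN spec, of i]
    from conjunct2[OF f_i] obtain a b and j k :: int where "\<forall>x y. (x, y) \<in> place (B i) ` Cantor2
      \<longrightarrow> f (x, y) = (a + 3 powi j * x, b + 3 powi k * y)"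
      by (elim exE)
    with conjunct1[OF f_i] show ?thesis using that by (rule rescale_unique)
  qed
  note f_pieces = this
  have "f p = \<psi> p" if pY: "p \<in> Y" for p
  proof -
    from B pY obtain n c where "c \<in> Cantor2" "p = place (B n) c" by (rule numbering_cover)
    then show ?thesis using f_pieces on_pieces by simp
  qed
  then show "f = \<psi>" using conjunct1[OF f] \<psi> by (metis extensionalityI)
qed

lemma pair_map_numbering:
  assumes A: "numbering A" and B: "numbering B"
  shows "pair_map (rect \<circ> A) (rect \<circ> B) = act A \<otimes>\<^bsub>bijections\<^esub> inv\<^bsub>bijections\<^esub> act B"
proof -
  interpret group bijections by (rule group_BijGroup)
  let ?\<psi> = "act A \<otimes>\<^bsub>bijections\<^esub> inv\<^bsub>bijections\<^esub> act B"
  have AB: "act A \<in> Bij Y" "act B \<in> Bij Y" using A B numbering_Bij by auto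
  then have \<psi>: "?\<psi> \<in> Bij Y" by (metis bijections_carrier inv_closed m_closed)
  have "act A \<in> carrier bijections" "act B \<in> carrier bijections"
    using AB by (simp_all only: bijections_carrier)
  then have "?\<psi> \<otimes>\<^bsub>bijections\<^esub> act B = act A" by (simp add: m_assoc)
  then have comp: "compose Y ?\<psi> (act B) = act A" using bijections_mult[OF \<psi> AB(2)] by simp
  show ?thesis
  proof (rule pair_map_eqI[OF B])
    show "?\<psi> \<in> extensional Y" using \<psi> by (rule Bij_imp_extensional)
    show "?\<psi> (place (B n) c) = place (A n) c" if "c \<in> Cantor2" for n c
      using fun_cong[OF comp, of "place (whole n) c"] that place_in_Y
      by (simp add: compose_eq act_whole)
  qed
qed

lemma elt_numbering: "numbering A \<Longrightarrow> elt (rect \<circ> A) = act A"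
proof -
  assume A: "numbering A"
  have "rect \<circ> whole = Sq" by (simp add: fun_eq_iff rect_whole)
  moreover have "pair_map (rect \<circ> A) (rect \<circ> whole) = act A"
    by (rule pair_map_eqI[OF numbering_whole act_extensional]) (rule act_whole)
  ultimately show ?thesis by (simp add: elt_def)
qed

section \<open>The presentation\<close>

fun family :: "bool option \<Rightarrow> nat \<Rightarrow> gen word set" where
  "family (Some True) = v"
| "family (Some False) = h"
| "family None = \<sigma>"

fun letter :: "bool option \<Rightarrow> bool \<Rightarrow> gen" where
  "letter (Some True) b = (if b then V1 else V0)"
| "letter (Some False) b = (if b then H1 else H0)"
| "letter None b = (if b then S1 else S0)"

lemma letter_surj: "\<exists>k b. g = letter k b"
proof (cases g)
  case V0 show ?thesis by (rule exI[of _ "Some True"], rule exI[of _ False]) (simp add: V0)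
next
  case V1 show ?thesis by (rule exI[of _ "Some True"], rule exI[of _ True]) (simp add: V1)
next
  case H0 show ?thesis by (rule exI[of _ "Some False"], rule exI[of _ False]) (simp add: H0)
next
  case H1 show ?thesis by (rule exI[of _ "Some False"], rule exI[of _ True]) (simp add: H1)
next
  case S0 show ?thesis by (rule exI[of _ None], rule exI[of _ False]) (simp add: S0)
next
  case S1 show ?thesis by (rule exI[of _ None], rule exI[of _ True]) (simp add: S1)
qed

interpretation F: group free_group
  by (rule group_free_group)

lemma family_symbol: "family k i = symbol (letter k False) (letter k True) i"
  by (cases k rule: family.cases) (simp_all add: v_def h_def \<sigma>_def)

lemma family_letter: "family k 0 = free_gen (letter k False)" "family k (Suc 0) = free_gen (letter k True)"
  by (simp_all add: family_symbol symbol_def)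

lemma free_gen_family: "\<exists>k i. free_gen g = family k i"
proof -
  obtain k b where "g = letter k b" using letter_surj by blast
  then show ?thesis using family_letter[of k] by (cases b) metis+
qed

lemma family_closed [simp]: "family k i \<in> carrier free_group"
  by (simp add: family_symbol symbol_def free_gen_closed)

text \<open>The letters of index at least 2 abbreviate conjugates by powers of \<open>v\<^sub>0\<close>, so this holds already in
  the free group.\<close>

lemma family_shift:
  "family k (Suc i) \<cdot> family (Some True) 0 = family (Some True) 0 \<cdot> family k (Suc (Suc i))"
proof -
  let ?a = "free_gen V0" and ?g = "free_gen (letter k True)"
  have a: "?a \<in> carrier free_group" and g: "?g \<in> carrier free_group" by (rule free_gen_closed)+
  have conj: "family k (Suc j) = ?a [^]\<^bsub>free_group\<^esub> (- int j) \<cdot> ?g \<cdot> ?a [^]\<^bsub>free_group\<^esub> (int j)" for j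
    using g by (cases j) (simp_all add: family_symbol symbol_def)
  have one: "?a [^]\<^bsub>free_group\<^esub> (1 :: int) = ?a" using a by simp
  have "?a \<cdot> ?a [^]\<^bsub>free_group\<^esub> (- int (Suc i)) = ?a [^]\<^bsub>free_group\<^esub> (- int i)"
    using F.int_pow_mult[OF a, of 1 "- int (Suc i)"] a by simp
  moreover have "?a [^]\<^bsub>free_group\<^esub> (int (Suc i)) = ?a [^]\<^bsub>free_group\<^esub> (int i) \<cdot> ?a"
    using F.int_pow_mult[OF a, of "int i" 1] a by (simp add: add.commute)
  ultimately have "?a \<cdot> family k (Suc (Suc i)) = family k (Suc i) \<cdot> ?a"
    unfolding conj[of i] conj[of "Suc i"] using a g
    by (simp add: F.m_assoc[symmetric] del: of_nat_Suc)
  then show ?thesis using family_letter[of "Some True"] by simp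
qed

lemma relations_closed: "relations \<subseteq> carrier free_group \<times> carrier free_group"
proof -
  have [simp]: "v i \<in> carrier free_group" "h i \<in> carrier free_group" "\<sigma> i \<in> carrier free_group" for i
    using family_closed[of "Some True" i] family_closed[of "Some False" i] family_closed[of None i] by auto
  show ?thesis unfolding relations_def by simp
qed

text \<open>Reading off the families of relations in a group where the listed relations hold.\<close>

lemma brin_presentation_family:
  assumes "group H" and \<theta>: "\<theta> \<in> hom free_group H"
    and holds: "\<And>l r. (l, r) \<in> relations \<Longrightarrow> \<theta> l = \<theta> r"
  shows "brin_presentation H (\<lambda>k i. \<theta> (family k i))"
proof -
  interpret H: group H by fact
  interpret \<theta>: group_hom free_group H \<theta> by (unfold_locales) (rule \<theta>)
  have two: "\<theta> a \<otimes>\<^bsub>H\<^esub> \<theta> b = \<theta> c \<otimes>\<^bsub>H\<^esub> \<theta> d"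
    if "(a \<cdot> b, c \<cdot> d) \<in> relations" "a \<in> carrier free_group" "b \<in> carrier free_group"
      "c \<in> carrier free_group" "d \<in> carrier free_group" for a b c d
    using holds[OF that(1)] that by simp
  show ?thesis
  proof unfold_locales
    show "\<theta> (family k i) \<in> carrier H" for k i by simp
    show "\<theta> (family k (Suc i)) \<otimes>\<^bsub>H\<^esub> \<theta> (family (Some True) 0)
        = \<theta> (family (Some True) 0) \<otimes>\<^bsub>H\<^esub> \<theta> (family k (Suc (Suc i)))" for k i
      using arg_cong[OF family_shift[of k i], of \<theta>] by (simp del: family.simps)
    show "\<theta> (family k j) \<otimes>\<^bsub>H\<^esub> \<theta> (family (Some d) 1)
        = \<theta> (family (Some d) 1) \<otimes>\<^bsub>H\<^esub> \<theta> (family k (Suc j))" if "j \<in> {2, 3}" for j k d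
      by (rule two) (use that in \<open>elim insertE emptyE; cases k rule: family.cases; cases d; simp add: relations_def flip: numeral_2_eq_2\<close>, simp_all del: family.simps)
    show "\<theta> (family k j) \<otimes>\<^bsub>H\<^esub> \<theta> (family (Some False) 0)
        = \<theta> (family (Some False) 0) \<otimes>\<^bsub>H\<^esub> \<theta> (family k (Suc j))" if "j \<in> {1, 2}" for j k
      by (rule two) (use that in \<open>elim insertE emptyE; cases k rule: family.cases; simp add: relations_def flip: numeral_2_eq_2\<close>, simp_all del: family.simps)
    show "\<theta> (family None 0) \<otimes>\<^bsub>H\<^esub> \<theta> (family k j) = \<theta> (family k j) \<otimes>\<^bsub>H\<^esub> \<theta> (family None 0)"
      if "j \<in> {2, 3}" for j k
      by (rule two) (use that in \<open>elim insertE emptyE; cases k rule: family.cases; simp add: relations_def flip: numeral_2_eq_2\<close>, simp_all del: family.simps)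
    show "\<theta> (family None 1) \<otimes>\<^bsub>H\<^esub> \<theta> (family k j) = \<theta> (family k j) \<otimes>\<^bsub>H\<^esub> \<theta> (family None 1)"
      if "j \<in> {3, 4}" for j k
      by (rule two) (use that in \<open>elim insertE emptyE; cases k rule: family.cases; simp add: relations_def flip: numeral_2_eq_2\<close>, simp_all del: family.simps)
    fix i :: nat assume i: "i \<in> {0, 1}"
    have "(family None i \<cdot> family (Some d) i, family (Some d) (Suc i) \<cdot> family None i \<cdot> family None (Suc i)) \<in> relations" for d
      using i by (elim insertE emptyE; cases d; simp add: relations_def flip: numeral_2_eq_2)
    from holds[OF this] show "\<theta> (family None i) \<otimes>\<^bsub>H\<^esub> \<theta> (family (Some d) i)
        = \<theta> (family (Some d) (Suc i)) \<otimes>\<^bsub>H\<^esub> \<theta> (family None i) \<otimes>\<^bsub>H\<^esub> \<theta> (family None (Suc i))" for d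
      by (simp del: family.simps)
    have "(family None i \<cdot> family None i, \<one>\<^bsub>free_group\<^esub>) \<in> relations"
      using i by (elim insertE emptyE; simp add: relations_def flip: numeral_2_eq_2)
    from holds[OF this] show "\<theta> (family None i) \<otimes>\<^bsub>H\<^esub> \<theta> (family None i) = \<one>\<^bsub>H\<^esub>"
      by (simp del: family.simps)
    have "(family None i \<cdot> family None (Suc i) \<cdot> family None i,
        family None (Suc i) \<cdot> family None i \<cdot> family None (Suc i)) \<in> relations"
      using i by (elim insertE emptyE; simp add: relations_def flip: numeral_2_eq_2)
    from holds[OF this] show "\<theta> (family None i) \<otimes>\<^bsub>H\<^esub> \<theta> (family None (Suc i)) \<otimes>\<^bsub>H\<^esub> \<theta> (family None i)
        = \<theta> (family None (Suc i)) \<otimes>\<^bsub>H\<^esub> \<theta> (family None i) \<otimes>\<^bsub>H\<^esub> \<theta> (family None (Suc i))"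
      by (simp del: family.simps)
    have "(family (Some True) i \<cdot> family (Some False) (Suc i) \<cdot> family (Some False) i,
        family (Some False) i \<cdot> family (Some True) (Suc i) \<cdot> family (Some True) i \<cdot> family None (Suc i)) \<in> relations"
      using i by (elim insertE emptyE; simp add: relations_def flip: numeral_2_eq_2)
    from holds[OF this] show
      "\<theta> (family (Some True) i) \<otimes>\<^bsub>H\<^esub> \<theta> (family (Some False) (Suc i)) \<otimes>\<^bsub>H\<^esub> \<theta> (family (Some False) i)
      = \<theta> (family (Some False) i) \<otimes>\<^bsub>H\<^esub> \<theta> (family (Some True) (Suc i)) \<otimes>\<^bsub>H\<^esub> \<theta> (family (Some True) i)
        \<otimes>\<^bsub>H\<^esub> \<theta> (family None (Suc i))"
      by (simp del: family.simps)
  qed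
qed

text \<open>Conversely, each listed relation is an instance of one of the infinite families.\<close>

lemma relations_hold:
  assumes "group H" and \<theta>: "\<theta> \<in> hom free_group H"
    and "numbering_monoid H (\<lambda>k i. \<theta> (family k i))" and "(l, r) \<in> relations"
  shows "\<theta> l = \<theta> r"
proof -
  interpret H: group H by fact
  interpret \<theta>: group_hom free_group H \<theta> by (unfold_locales) (rule \<theta>)
  interpret M: numbering_monoid H "\<lambda>k i. \<theta> (family k i)" by fact
  have commute: "\<theta> (family k j \<cdot> family (Some d) i) = \<theta> (family (Some d) i \<cdot> family k j')"
    if "i < j" "j' = Suc j" for k d i j j'
    using M.commute[OF that(1)] that(2) by (simp del: family.simps)
  have far: "\<theta> (family None i \<cdot> family k j) = \<theta> (family k j \<cdot> family None i)"
    if "Suc i < j" for k i j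
    using M.far[OF that] by (simp del: family.simps)
  have turn: "\<theta> (family None i \<cdot> family (Some d) i) = \<theta> (family (Some d) j \<cdot> family None i \<cdot> family None j)"
    if "j = Suc i" for d i j
    using M.turn that by (simp add: H.m_assoc del: family.simps)
  have square: "\<theta> (family None i \<cdot> family None i) = \<theta> \<one>\<^bsub>free_group\<^esub>" for i
    using M.square by (simp del: family.simps)
  have braid: "\<theta> (family None i \<cdot> family None j \<cdot> family None i) = \<theta> (family None j \<cdot> family None i \<cdot> family None j)"
    if "j = Suc i" for i j
    using M.braid that by (simp add: H.m_assoc del: family.simps)
  have cross: "\<theta> (family (Some True) i \<cdot> family (Some False) j \<cdot> family (Some False) i)
      = \<theta> (family (Some False) i \<cdot> family (Some True) j \<cdot> family (Some True) i \<cdot> family None j)"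
    if "j = Suc i" for i j
    using M.cross that by (simp add: H.m_assoc del: family.simps)
  have "\<forall>(l, r)\<in>relations. \<theta> l = \<theta> r"
    unfolding relations_def family.simps[symmetric]
    by (simp only: ball_simps prod.case, intro conjI TrueI)
      ((rule commute; simp; fail) | (rule far; simp; fail) | (rule turn; simp; fail)
        | rule square | (rule braid; simp; fail) | (rule cross; simp; fail))+
  then show ?thesis using assms(4) by blast
qed

lemma gen_elt_letter: "gen_elt (letter k b) = act (numbering_gen k (if b then 1 else 0))"
proof -
  have "elt (v_pattern i) = act (cut_numbering True i)" "elt (h_pattern i) = act (cut_numbering False i)"
    "elt (\<sigma>_pattern i) = act (swap_numbering i)" for i
    using elt_numbering[OF numbering_generator[of "Some True" i]] elt_numbering[OF numbering_generator[of "Some False" i]]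
      elt_numbering[OF numbering_generator[of None i]]
    by (simp_all only: numbering_gen.simps rect_cut_True rect_cut_False rect_swap)
  then show ?thesis by (cases k rule: family.cases) simp_all
qed

theorem theorem4:
  shows "is_presented_by hat2V gen_elt relations"
proof -
  interpret B: group bijections by (rule group_BijGroup)
  have act_closed: "act (numbering_gen k i) \<in> carrier bijections" for k i
    by (simp only: bijections_carrier act_gen_Bij)
  have gen_closed: "gen_elt g \<in> carrier bijections" for g
    using letter_surj[of g] act_closed by (auto simp: gen_elt_letter)
  obtain \<theta> where \<theta>: "\<theta> \<in> hom free_group bijections"
    and \<theta>_gen: "\<And>g. \<theta> (free_gen g) = gen_elt g"
    by (rule free_group_extension[where f = gen_elt, OF group_BijGroup gen_closed]) (rule that)
  interpret \<theta>: group_hom free_group bijections \<theta> by unfold_locales (rule \<theta>)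
  have after: "act A \<otimes>\<^bsub>bijections\<^esub> act B = act (A \<Zsemi> B)"
    if "act A \<in> carrier bijections" "act B \<in> carrier bijections" for A B
    using that act_mult by (simp only: bijections_carrier)
  have \<theta>_family: "\<theta> (family k i) = act (numbering_gen k i)" for k i
  proof (induction i rule: induct_nat_012)
    case (ge2 i)
    let ?a = "numbering_gen (Some True) 0"
    have v0: "\<theta> (family (Some True) 0) = act ?a"
      unfolding family_letter \<theta>_gen gen_elt_letter by simp
    have "act ?a \<otimes>\<^bsub>bijections\<^esub> \<theta> (family k (Suc (Suc i)))
        = \<theta> (family (Some True) 0 \<cdot> family k (Suc (Suc i)))"
      by (simp add: v0 del: family.simps numbering_gen.simps)
    also have "\<dots> = act (numbering_gen k (Suc i)) \<otimes>\<^bsub>bijections\<^esub> act ?a"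
      using ge2 by (simp add: family_shift[symmetric] v0 del: family.simps numbering_gen.simps)
    also have "\<dots> = act (?a \<Zsemi> numbering_gen k (Suc (Suc i)))"
      using N.commute[of 0 "Suc i" k True] by (simp only: after[OF act_closed act_closed] numberings_simps)
    also have "\<dots> = act ?a \<otimes>\<^bsub>bijections\<^esub> act (numbering_gen k (Suc (Suc i)))"
      by (simp only: after[OF act_closed act_closed])
    finally show ?case by (simp add: act_closed del: family.simps numbering_gen.simps)
  qed (simp_all add: family_letter \<theta>_gen gen_elt_letter)
  have act_closed2: "act (A \<Zsemi> B) \<in> carrier bijections"
    if "act A \<in> carrier bijections" "act B \<in> carrier bijections" for A B
    using B.m_closed[OF that] after[OF that] by simp
  have "numbering_monoid bijections (\<lambda>k i. act (numbering_gen k i))"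
  proof (intro numbering_monoid.intro numbering_monoid_axioms.intro)
    show "Group.monoid bijections" by (rule B.is_monoid)
    show "act (numbering_gen None i) \<otimes>\<^bsub>bijections\<^esub> act (numbering_gen None i) = \<one>\<^bsub>bijections\<^esub>" for i
      using N.square[of i] act_id by (simp only: after act_closed numberings_simps) (simp add: BijGroup_def)
    show "act (numbering_gen (Some True) i) \<otimes>\<^bsub>bijections\<^esub>
        (act (numbering_gen (Some False) (Suc i)) \<otimes>\<^bsub>bijections\<^esub> act (numbering_gen (Some False) i))
      = act (numbering_gen (Some False) i) \<otimes>\<^bsub>bijections\<^esub>
        (act (numbering_gen (Some True) (Suc i)) \<otimes>\<^bsub>bijections\<^esub>
          (act (numbering_gen (Some True) i) \<otimes>\<^bsub>bijections\<^esub> act (numbering_gen None (Suc i))))" for i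
      using N.cross[of i] by (simp only: after act_closed act_closed2 numberings_simps)
  qed (simp_all only: after act_closed act_closed2 N.commute[unfolded numberings_simps]
      N.far[unfolded numberings_simps] N.turn[unfolded numberings_simps]
      N.braid[unfolded numberings_simps])
  then have "numbering_monoid bijections (\<lambda>k i. \<theta> (family k i))" unfolding \<theta>_family .
  then have holds: "\<theta> l = \<theta> r" if "(l, r) \<in> relations" for l r
    using relations_hold[OF group_BijGroup \<theta> _ that] by blast
  \<comment> \<open>\<open>?\<Gamma>\<close> below is the presented group, with projection \<open>q\<close>\<close>
  define M where "M = normal_closure free_group (relators relations)"
  define q where "q g = M #>\<^bsub>free_group\<^esub> g" for g
  let ?\<Gamma> = "free_group Mod M"
  interpret M: normal M free_group
    unfolding M_def by (rule F.normal_closure_normal[OF relators_closed[OF relations_closed]])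
  have \<Gamma>: "group ?\<Gamma>" by (rule M.factorgroup_is_group)
  have q_hom: "q \<in> hom free_group ?\<Gamma>"
    unfolding q_def by (rule M.r_coset_hom_Mod)
  interpret q: group_hom free_group ?\<Gamma> q
    using \<Gamma> q_hom by (intro group_hom.intro group_free_group group_hom_axioms.intro)
  interpret \<Gamma>: brin_presentation ?\<Gamma> "\<lambda>k i. q (family k i)"
  proof (rule brin_presentation_family[OF \<Gamma> q_hom])
    show "(l, r) \<in> relations \<Longrightarrow> q l = q r" for l r
      unfolding q_def M_def by (rule presented_group_relation[OF relations_closed])
  qed
  interpret P: numbering_rep "?\<Gamma> \<times>\<times> numberings" "\<lambda>k i. (q (family k i), numbering_gen k i)" snd
    by (rule \<Gamma>.pair_rep)
  have \<theta>_q: "\<theta> g = \<theta> g'" if "g \<in> carrier free_group" "g' \<in> carrier free_group" "q g = q g'" for g g'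
  proof -
    have "g \<in> M #>\<^bsub>free_group\<^esub> g'" using F.rcos_self[OF that(1) M.subgroup_axioms] that(3) by (simp add: q_def)
    then obtain m where m: "m \<in> M" "g = m \<cdot> g'" unfolding r_coset_def by blast
    have "M \<subseteq> kernel free_group bijections \<theta>"
      unfolding M_def using normal_closure_subset_kernel[OF group_BijGroup \<theta> relations_closed holds] .
    then have "m \<in> carrier free_group" "\<theta> m = \<one>\<^bsub>bijections\<^esub>" using m by (auto simp: kernel_def)
    then show ?thesis using m that by simp
  qed
  \<comment> \<open>a positive element of the presented group is paired with the numbering of a word for it\<close>
  have pairing: "\<exists>A. P.positive n (p, A)" if "\<Gamma>.positive n p" for n p
    using that
  proof (induction rule: \<Gamma>.positive.induct)
    case one
    show ?case using P.positive.one by (auto simp: DirProd_def)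
  next
    case (swap n g i)
    then obtain A where "P.positive n (g, A)" by blast
    from P.positive.swap[OF this, of i] show ?case by (auto simp: DirProd_def)
  next
    case (cut n g d i)
    then obtain A where "P.positive n (g, A)" by blast
    from P.positive.cut[OF this, of d i] show ?case by (auto simp: DirProd_def)
  qed
  have step: "family k i \<cdot> u \<in> carrier free_group
      \<and> q (family k i \<cdot> u) = fst ((q (family k i), numbering_gen k i) \<otimes>\<^bsub>?\<Gamma> \<times>\<times> numberings\<^esub> pA)
      \<and> \<theta> (family k i \<cdot> u) = act (snd ((q (family k i), numbering_gen k i) \<otimes>\<^bsub>?\<Gamma> \<times>\<times> numberings\<^esub> pA))
      \<and> numbering (snd ((q (family k i), numbering_gen k i) \<otimes>\<^bsub>?\<Gamma> \<times>\<times> numberings\<^esub> pA))"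
    if u: "u \<in> carrier free_group" "q u = fst pA" "\<theta> u = act (snd pA)" "numbering (snd pA)" for u pA k i
  proof -
    have "act (snd pA) \<in> carrier bijections" using u(1,3) \<theta>.hom_closed by metis
    then show ?thesis
      using u numbering_after[OF numbering_generator u(4)]
      by (simp add: DirProd_def case_prod_beta \<theta>_family after[OF act_closed] del: family.simps mult_FactGroup)
  qed
  have word: "\<exists>u\<in>carrier free_group. q u = fst pA \<and> \<theta> u = act (snd pA) \<and> numbering (snd pA)"
    if "P.positive n pA" for n pA
    using that
  proof (induction rule: P.positive.induct)
    case one
    have "\<theta> \<one>\<^bsub>free_group\<^esub> = act whole" by (simp add: act_id) (simp add: BijGroup_def)
    then show ?case using numbering_whole by (intro bexI[of _ "\<one>\<^bsub>free_group\<^esub>"]) (auto simp: DirProd_def)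
  next
    case (swap n pA i)
    then obtain u where u: "u \<in> carrier free_group" "q u = fst pA" "\<theta> u = act (snd pA)" "numbering (snd pA)"
      by blast
    show ?case by (rule bexI[of _ "family None i \<cdot> u"]) (use step[OF u, of None i] in auto)
  next
    case (cut n pA d i)
    then obtain u where u: "u \<in> carrier free_group" "q u = fst pA" "\<theta> u = act (snd pA)" "numbering (snd pA)"
      by blast
    show ?case by (rule bexI[of _ "family (Some d) i \<cdot> u"]) (use step[OF u, of "Some d" i] in auto)
  qed
  have numbering_word: "\<exists>u\<in>carrier free_group. \<theta> u = act A" if "numbering A" for A
  proof -
    from that obtain n where "N.positive n A" unfolding numbering_def by blast
    then show ?thesis
    proof (induction rule: N.positive.induct)
      case one
      have "\<theta> \<one>\<^bsub>free_group\<^esub> = act whole" by (simp add: act_id) (simp add: BijGroup_def)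
      then show ?case by (intro bexI[of _ "\<one>\<^bsub>free_group\<^esub>"]) auto
    next
      case (swap n A i)
      then obtain u where u: "u \<in> carrier free_group" "\<theta> u = act A" by blast
      then have "act A \<in> carrier bijections" using \<theta>.hom_closed by metis
      then show ?case using u
        by (intro bexI[of _ "family None i \<cdot> u"]) (simp_all add: \<theta>_family after act_closed del: family.simps numbering_gen.simps)
    next
      case (cut n A d i)
      then obtain u where u: "u \<in> carrier free_group" "\<theta> u = act A" by blast
      then have "act A \<in> carrier bijections" using \<theta>.hom_closed by metis
      then show ?case using u
        by (intro bexI[of _ "family (Some d) i \<cdot> u"]) (simp_all add: \<theta>_family after act_closed del: family.simps numbering_gen.simps)
    qed
  qed
  have fraction: "\<exists>n p m p'. \<Gamma>.positive n p \<and> \<Gamma>.positive m p' \<and> q g = p \<otimes>\<^bsub>?\<Gamma>\<^esub> inv\<^bsub>?\<Gamma>\<^esub> p'"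
    if "g \<in> carrier free_group" for g
    using that
  proof (induction rule: free_group_induct)
    case one
    have "q \<one>\<^bsub>free_group\<^esub> = \<one>\<^bsub>?\<Gamma>\<^esub> \<otimes>\<^bsub>?\<Gamma>\<^esub> inv\<^bsub>?\<Gamma>\<^esub> \<one>\<^bsub>?\<Gamma>\<^esub>"
      by (simp del: one_FactGroup mult_FactGroup)
    then show ?case using \<Gamma>.positive.one by blast
  next
    case (gen x g)
    then obtain n p m p' where p: "\<Gamma>.positive n p" "\<Gamma>.positive m p'" "q g = p \<otimes>\<^bsub>?\<Gamma>\<^esub> inv\<^bsub>?\<Gamma>\<^esub> p'"
      by blast
    obtain k i where x: "free_gen x = family k i" using free_gen_family by blast
    have "q (free_gen x \<cdot> g) = q (family k i) \<otimes>\<^bsub>?\<Gamma>\<^esub> p \<otimes>\<^bsub>?\<Gamma>\<^esub> inv\<^bsub>?\<Gamma>\<^esub> p'"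
      using p gen.hyps by (simp add: x q.H.m_assoc del: mult_FactGroup family.simps)
    then show ?case using \<Gamma>.positive_gen_left[OF p(1), of k i] p(2) by blast
  next
    case (inv_gen x g)
    then obtain n p m p' where p: "\<Gamma>.positive n p" "\<Gamma>.positive m p'" "q g = p \<otimes>\<^bsub>?\<Gamma>\<^esub> inv\<^bsub>?\<Gamma>\<^esub> p'"
      by blast
    obtain k i where x: "free_gen x = family k i" using free_gen_family by blast
    have "q (inv\<^bsub>free_group\<^esub> free_gen x \<cdot> g)
        = inv\<^bsub>?\<Gamma>\<^esub> q (family k i) \<otimes>\<^bsub>?\<Gamma>\<^esub> (p \<otimes>\<^bsub>?\<Gamma>\<^esub> inv\<^bsub>?\<Gamma>\<^esub> p')"
      using p inv_gen.hyps by (simp add: x del: mult_FactGroup family.simps)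
    then show ?case using \<Gamma>.fraction_inv_gen[OF p(1,2), of k i] by metis
  qed
  \<comment> \<open>every word equals a quotient of positive elements, and acts as the quotient of their numberings\<close>
  have fraction_word: "\<exists>n p A m p' A'. P.positive n (p, A) \<and> P.positive m (p', A')
      \<and> q g = p \<otimes>\<^bsub>?\<Gamma>\<^esub> inv\<^bsub>?\<Gamma>\<^esub> p' \<and> numbering A \<and> numbering A'
      \<and> \<theta> g = act A \<otimes>\<^bsub>bijections\<^esub> inv\<^bsub>bijections\<^esub> act A'"
    if g: "g \<in> carrier free_group" for g
  proof -
    from fraction[OF g] obtain n p m p' where
      p: "\<Gamma>.positive n p" "\<Gamma>.positive m p'" "q g = p \<otimes>\<^bsub>?\<Gamma>\<^esub> inv\<^bsub>?\<Gamma>\<^esub> p'" by blast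
    from pairing[OF p(1)] pairing[OF p(2)] obtain A A' where
      A: "P.positive n (p, A)" "P.positive m (p', A')" by blast
    from word[OF A(1)] obtain u where
      u: "u \<in> carrier free_group" "q u = p" "\<theta> u = act A" "numbering A" by auto
    from word[OF A(2)] obtain u' where
      u': "u' \<in> carrier free_group" "q u' = p'" "\<theta> u' = act A'" "numbering A'" by auto
    have "u \<cdot> inv\<^bsub>free_group\<^esub> u' \<in> carrier free_group" using u(1) u'(1) by simp
    moreover have "q g = q (u \<cdot> inv\<^bsub>free_group\<^esub> u')" using p(3) u u' by (simp del: mult_FactGroup)
    ultimately have "\<theta> g = \<theta> (u \<cdot> inv\<^bsub>free_group\<^esub> u')" by (rule \<theta>_q[OF g])
    then have "\<theta> g = act A \<otimes>\<^bsub>bijections\<^esub> inv\<^bsub>bijections\<^esub> act A'" using u u' by simp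
    then show ?thesis using A p(3) u(4) u'(4) by (intro exI conjI)
  qed
  have kernel: "g \<in> normal_closure free_group (relators relations)"
    if g: "g \<in> carrier free_group" "\<theta> g = \<one>\<^bsub>bijections\<^esub>" for g
  proof -
    from fraction_word[OF g(1)] obtain n p A m p' A' where
      A: "P.positive n (p, A)" "P.positive m (p', A')" "q g = p \<otimes>\<^bsub>?\<Gamma>\<^esub> inv\<^bsub>?\<Gamma>\<^esub> p'"
        "numbering A" "numbering A'" "\<theta> g = act A \<otimes>\<^bsub>bijections\<^esub> inv\<^bsub>bijections\<^esub> act A'"
      by blast
    have closed: "act A \<in> carrier bijections" "act A' \<in> carrier bijections"
      using A(4,5) numbering_Bij by (simp_all only: bijections_carrier)
    have "act A = act A \<otimes>\<^bsub>bijections\<^esub> inv\<^bsub>bijections\<^esub> act A' \<otimes>\<^bsub>bijections\<^esub> act A'"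
      using closed by (simp add: B.m_assoc)
    also have "\<dots> = act A'" using A(6) g(2) closed by simp
    finally have "A = A'" by (rule act_inj)
    then have "(p, A) = (p', A')" by (intro P.positive_unique[OF A(1,2)]) simp
    moreover have "p \<in> carrier ?\<Gamma>" using P.positive_closed[OF A(1)] by (simp add: DirProd_def)
    ultimately have "q g = \<one>\<^bsub>?\<Gamma>\<^esub>" using A(3) by (simp del: mult_FactGroup one_FactGroup)
    then have "M #>\<^bsub>free_group\<^esub> g = M" by (simp add: q_def)
    then have "g \<in> M" using F.rcos_self[OF g(1) M.subgroup_axioms] by simp
    then show ?thesis by (simp add: M_def)
  qed
  have hat2V: "hat2V = bijections\<lparr>carrier := \<theta> ` carrier free_group\<rparr>"
  proof -
    have "{pair_map P Q | P Q. numbered_pattern P \<and> numbered_pattern Q} = \<theta> ` carrier free_group"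
      (is "?L = ?R")
    proof
      show "?R \<subseteq> ?L"
      proof (rule image_subsetI)
        fix g :: "gen word set" assume "g \<in> carrier free_group"
        from fraction_word[OF this] obtain A A' where "numbering A" "numbering A'"
          "\<theta> g = act A \<otimes>\<^bsub>bijections\<^esub> inv\<^bsub>bijections\<^esub> act A'" by blast
        then have "\<theta> g = pair_map (rect \<circ> A) (rect \<circ> A')" by (simp only: pair_map_numbering)
        with \<open>numbering A\<close> \<open>numbering A'\<close> show "\<theta> g \<in> ?L" using numbering_numbered_pattern by blast
      qed
      show "?L \<subseteq> ?R"
      proof
        fix f assume "f \<in> ?L"
        then obtain P Q where PQ: "f = pair_map P Q" "numbered_pattern P" "numbered_pattern Q" by blast
        obtain A where A: "numbering A" "P = rect \<circ> A" using PQ(2) by (rule numbered_pattern_numbering)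
        obtain A' where A': "numbering A'" "Q = rect \<circ> A'" using PQ(3) by (rule numbered_pattern_numbering)
        obtain u where u: "u \<in> carrier free_group" "\<theta> u = act A" using numbering_word[OF A(1)] by blast
        obtain u' where u': "u' \<in> carrier free_group" "\<theta> u' = act A'" using numbering_word[OF A'(1)] by blast
        have "f = \<theta> (u \<cdot> inv\<^bsub>free_group\<^esub> u')"
          using u u' PQ(1) A A' by (simp add: pair_map_numbering)
        then show "f \<in> ?R" using u(1) u'(1) by blast
      qed
    qed
    then show ?thesis by (simp add: hat2V_def)
  qed
  show ?thesis
    unfolding hat2V using group_BijGroup \<theta> \<theta>_gen relations_closed holds kernel by (rule is_presented_byI)
qed

end
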